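(* Let $d\ge1$ and let $X$ be the subordinate Brownian motion in $\mathbb{R}^d$ whose subordinator $S$ has Laplace exponent $\phi$. If (A-1), (A-3) and (B) hold and $X$ is transient, then the radial Green function $g$ of $X$ satisfies $$g(r)\asymp r^{-d-2}\frac{\phi'(r^{-2})}{\phi(r^{-2})^2},\quad r\to0+ .$$
   Context: $B=(B_t,\mathbb{P}_x)$ is a Brownian motion in $\mathbb{R}^d$ with $\mathbb{E}_x e^{i\langle\xi,B_t-B_0\rangle}=e^{-t|\xi|^2}$. $S=(S_t)_{t\ge0}$ is a subordinator (Lévy process with values in $[0,\infty)$ started at $0$) independent of $B$, with Laplace exponent $\phi$ given by $\mathbb{E}e^{-\lambda S_t}=e^{-t\phi(\lambda)}$ and potential measure $U(A)=\int_0^\infty\mathbb{P}(S_t\in A)\,dt$. $X_t=B(S_t)$ is a Lévy process with characteristic exponent $\phi(|\xi|^2)$. $X$ is transient if $\mathbb{P}_0(\lim_{t\to\infty}|X_t|=\infty)=1$; in that case its Green function is $G(x,y)=g(|y-x|)$ with $$g(r)=\int_{(0,\infty)}(4\pi t)^{-d/2}\exp\left(-\tfrac{r^2}{4t}\right)U(dt),\quad r>0.$$ "Decreasing" means: $s\le t$ implies $f(s)\ge f(t)$. $f(r)\asymp g(r)$, $r\to0+$, means that the quotient stays between two positive constants as $r\to0+$. (A-1) $U$ has a decreasing density $u\colon(0,\infty)\to(0,\infty)$, $U(dt)=u(t)\,dt$. (A-3) There exist constants $\sigma>0$, $\lambda_0>0$, $\delta>0$ such that $\frac{\phi'(\lambda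 x)}{\phi'(\lambda)}\le\sigma x^{-\delta}$ for all $x\ge1$ and $\lambda\ge\lambda_0$. (B) If $d\le2$: $d+2\delta-2>0$ with $\delta$ (and $\lambda_0$) the constant(s) from (A-3), and there are $\sigma'>0$ and $\delta'\in\left(1-\tfrac d2,\,(1+\tfrac d2)\wedge(2\delta+\tfrac{d-2}{2})\right)$ such that $\frac{\phi'(\lambda x)}{\phi'(\lambda)}\ge\sigma' x^{-\delta'}$ for all $x\ge1$ and $\lambda\ge\lambda_0$. (If $d\ge3$, (B) imposes nothing.) *)

theory Defs
  imports "HOL-Probability.Probability"
begin

definition independent_increments ::
  "'w measure \<Rightarrow> (real \<Rightarrow> 'w \<Rightarrow> 'a::euclidean_space) \<Rightarrow> bool" where
  "independent_increments P X \<longleftrightarrow>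
     (\<forall>n (t :: nat \<Rightarrow> real). 0 \<le> t 0 \<longrightarrow> (\<forall>i<n. t i \<le> t (Suc i)) \<longrightarrow>
        prob_space.indep_vars P (\<lambda>_. borel) (\<lambda>i \<omega>. X (t (Suc i)) \<omega> - X (t i) \<omega>) {..<n})"

definition stationary_increments ::
  "'w measure \<Rightarrow> (real \<Rightarrow> 'w \<Rightarrow> 'a::euclidean_space) \<Rightarrow> bool" where
  "stationary_increments P X \<longleftrightarrow>
     (\<forall>s\<ge>0. \<forall>t\<ge>0. distr P borel (\<lambda>\<omega>. X (s + t) \<omega> - X s \<omega>) =
                     distr P borel (\<lambda>\<omega>. X t \<omega> - X 0 \<omega>))"

definition cadlag :: "(real \<Rightarrow> 'a::euclidean_space) \<Rightarrow> bool" where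
  "cadlag f \<longleftrightarrow>
     (\<forall>t\<ge>0. continuous (at_right t) f) \<and> (\<forall>t>0. \<exists>l. (f \<longlongrightarrow> l) (at_left t))"

text \<open>Processes are families indexed by real times, of which only the times
  \<open>t \<ge> 0\<close> matter.\<close>

definition levy_process ::
  "'w measure \<Rightarrow> 'a \<Rightarrow> (real \<Rightarrow> 'w \<Rightarrow> 'a::euclidean_space) \<Rightarrow> bool" where
  "levy_process P x X \<longleftrightarrow>
     prob_space P \<and>
     (\<forall>t\<ge>0. X t \<in> borel_measurable P) \<and>
     (AE \<omega> in P. X 0 \<omega> = x) \<and>
     independent_increments P X \<and>
     stationary_increments P X \<and>
     (AE \<omega> in P. cadlag (\<lambda>t. X t \<omega>))"

text \<open>The normalisation is that of the generator \<open>\<Delta>\<close> (not \<open>\<Delta>/2\<close>): each coordinate of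
  \<open>B t - B 0\<close> has variance \<open>2 * t\<close>.\<close>

definition brownian_motion ::
  "'w measure \<Rightarrow> 'a \<Rightarrow> (real \<Rightarrow> 'w \<Rightarrow> 'a::euclidean_space) \<Rightarrow> bool" where
  "brownian_motion P x B \<longleftrightarrow>
     levy_process P x B \<and>
     (AE \<omega> in P. continuous_on {0..} (\<lambda>t. B t \<omega>)) \<and>
     (\<forall>t\<ge>0. \<forall>\<xi>. (CLINT \<omega>|P. exp (\<i> * complex_of_real (\<xi> \<bullet> (B t \<omega> - B 0 \<omega>)))) =
                 complex_of_real (exp (- t * (norm \<xi>)\<^sup>2)))"

definition subordinator :: "'w measure \<Rightarrow> (real \<Rightarrow> 'w \<Rightarrow> real) \<Rightarrow> bool" where
  "subordinator P S \<longleftrightarrow>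
     levy_process P 0 S \<and> (\<forall>t\<ge>0. \<forall>\<omega>\<in>space P. S t \<omega> \<ge> 0)"

definition laplace_exponent ::
  "'w measure \<Rightarrow> (real \<Rightarrow> 'w \<Rightarrow> real) \<Rightarrow> (real \<Rightarrow> real) \<Rightarrow> bool" where
  "laplace_exponent P S \<phi> \<longleftrightarrow>
     (\<forall>t\<ge>0. \<forall>l>0. (LINT \<omega>|P. exp (- l * S t \<omega>)) = exp (- t * \<phi> l))"

definition process_events ::
  "'w measure \<Rightarrow> (real \<Rightarrow> 'w \<Rightarrow> 'a::euclidean_space) \<Rightarrow> 'w set set" where
  "process_events P X =
     sigma_sets (space P) {X t -` A \<inter> space P | t A. t \<ge> 0 \<and> A \<in> sets borel}"

text \<open>The library's \<open>indep_var\<close> requires both random elements to have the same type,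
  hence the formulation through the generated sigma-algebras.\<close>

definition independent_processes ::
  "'w measure \<Rightarrow> (real \<Rightarrow> 'w \<Rightarrow> 'a::euclidean_space) \<Rightarrow> (real \<Rightarrow> 'w \<Rightarrow> 'b::euclidean_space) \<Rightarrow> bool" where
  "independent_processes P X Y \<longleftrightarrow>
     prob_space.indep_set P (process_events P X) (process_events P Y)"

definition subordinate ::
  "(real \<Rightarrow> 'w \<Rightarrow> 'a) \<Rightarrow> (real \<Rightarrow> 'w \<Rightarrow> real) \<Rightarrow> real \<Rightarrow> 'w \<Rightarrow> 'a" where
  "subordinate B S t \<omega> = B (S t \<omega>) \<omega>"

definition transient ::
  "'w measure \<Rightarrow> (real \<Rightarrow> 'w \<Rightarrow> 'a::euclidean_space) \<Rightarrow> bool" where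
  "transient P X \<longleftrightarrow> (AE \<omega> in P. filterlim (\<lambda>t. norm (X t \<omega>)) at_top at_top)"

definition potential_measure :: "'w measure \<Rightarrow> (real \<Rightarrow> 'w \<Rightarrow> real) \<Rightarrow> real measure" where
  "potential_measure P S =
     measure_of UNIV (sets borel)
       (\<lambda>A. \<integral>\<^sup>+t\<in>{0..}. emeasure P {\<omega> \<in> space P. S t \<omega> \<in> A} \<partial>lborel)"

text \<open>The radial Green function in dimension \<open>d\<close>. The Bochner integral of a non-integrable
  function is \<open>0\<close>, so a positive value of \<open>green d U r\<close> includes convergence of the integral.\<close>

definition green :: "nat \<Rightarrow> real measure \<Rightarrow> real \<Rightarrow> real" where
  "green d U r =
     (LINT t:{0<..}|U. (4 * pi * t) powr (- real d / 2) * exp (- r\<^sup>2 / (4 * t)))"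

definition cond_A1 :: "real measure \<Rightarrow> bool" where
  "cond_A1 U \<longleftrightarrow>
     (\<exists>u :: real \<Rightarrow> real. (\<forall>t>0. u t > 0) \<and> antimono_on {0<..} u \<and>
        U = density lborel (\<lambda>t. ennreal (u t) * indicator {0<..} t))"

definition cond_A3 :: "(real \<Rightarrow> real) \<Rightarrow> real \<Rightarrow> real \<Rightarrow> real \<Rightarrow> bool" where
  "cond_A3 \<phi> \<sigma> l\<^sub>0 \<delta> \<longleftrightarrow>
     \<sigma> > 0 \<and> l\<^sub>0 > 0 \<and> \<delta> > 0 \<and>
     (\<forall>x\<ge>1. \<forall>l\<ge>l\<^sub>0. deriv \<phi> (l * x) / deriv \<phi> l \<le> \<sigma> * x powr (- \<delta>))"

text \<open>\<open>l\<^sub>0\<close> and \<open>\<delta>\<close> are the constants of \<^const>\<open>cond_A3\<close>.\<close>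

definition cond_B :: "nat \<Rightarrow> (real \<Rightarrow> real) \<Rightarrow> real \<Rightarrow> real \<Rightarrow> bool" where
  "cond_B d \<phi> l\<^sub>0 \<delta> \<longleftrightarrow>
     (d \<le> 2 \<longrightarrow>
        real d + 2 * \<delta> - 2 > 0 \<and>
        (\<exists>\<sigma>'>0. \<exists>\<delta>'\<in>{1 - real d / 2 <..< min (1 + real d / 2) (2 * \<delta> + (real d - 2) / 2)}.
           \<forall>x\<ge>1. \<forall>l\<ge>l\<^sub>0. deriv \<phi> (l * x) / deriv \<phi> l \<ge> \<sigma>' * x powr (- \<delta>')))"

text \<open>Two-sided comparability as \<open>r \<rightarrow> 0+\<close>. Unlike \<open>\<Theta>\<close>, this compares signed quotients,
  and by \<open>x / 0 = 0\<close> it forces both functions to be nonzero near \<open>0\<close>.\<close>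

definition comparable_at_0 :: "(real \<Rightarrow> real) \<Rightarrow> (real \<Rightarrow> real) \<Rightarrow> bool" where
  "comparable_at_0 f g \<longleftrightarrow>
     (\<exists>c>0. \<exists>C>0. \<forall>\<^sub>F r in at_right 0. c \<le> f r / g r \<and> f r / g r \<le> C)"

end

theory Submission
  imports Defs
begin

text \<open>
  Let \<open>v\<close> be the density of the potential measure \<open>U\<close>, extended by \<open>0\<close> to the left half-line. Its
  Laplace transform is \<open>laplace l = \<integral> exp (- l t) v t dt = 1 / \<phi> l\<close>. With
  \<open>moment l = - laplace' l = \<integral> t exp (- l t) v t dt\<close> this gives \<open>\<phi>' = moment / laplace\<^sup>2\<close>, hence
  \<open>\<phi>' / \<phi>\<^sup>2 = moment\<close>. Writing \<open>\<rho> = r\<^sup>2\<close>, the claim is that the heat kernel integral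
  \<open>\<integral> (4 \<pi> t) powr (- d/2) exp (- \<rho> / (4 t)) v t dt\<close> is comparable to
  \<open>\<rho> powr (- d/2 - 1) * moment (1/\<rho>)\<close>, which is a statement about decreasing functions on the half-line.

  A decreasing \<open>v\<close> always satisfies \<open>t\<^sup>2 v t \<le> 4 e moment (1/t)\<close>. The growth bound on \<open>\<phi>'\<close> says that
  \<open>moment\<close> decays at a power rate, so the part of \<open>moment (1/t)\<close> coming from times much smaller than \<open>t\<close>
  is negligible, and the reverse inequality holds for small \<open>t\<close> (lemma \<open>moment_le_density_scaling\<close>).
  The lower bound for the Green function comes from times in \<open>[\<rho>/2, \<rho>]\<close> alone.

  For the upper bound, times below \<open>\<rho>\<close> are damped by the exponential. Times between \<open>\<rho>\<close> and a fixed
  \<open>t\<^sub>0\<close> contribute the right order as soon as \<open>moment (1/t) \<le> C (t/\<rho>) powr \<kappa> moment (1/\<rho>)\<close> for some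
  \<open>\<kappa> < 1 + d/2\<close>. For \<open>d \<ge> 3\<close> one takes \<open>\<kappa> = 2\<close>, directly from the monotonicity of \<open>v\<close>. For
  \<open>d \<le> 2\<close> the lower bound on \<open>\<phi>'\<close> is combined with \<open>\<phi> (l x) \<le> C x powr (1 - \<delta>) \<phi> l\<close>, which is the
  upper bound on \<open>\<phi>'\<close> integrated. Here \<open>\<delta>\<close> is first lowered to a value below \<open>1\<close> if necessary. This
  yields \<open>\<kappa> = \<delta>' + 2 (1 - \<delta>)\<close>, and the upper end of the range of \<open>\<delta>'\<close> is what makes this less than
  \<open>1 + d/2\<close> (lemma \<open>heat_integral_comparable\<close>).

  Times above \<open>t\<^sub>0\<close> contribute a constant, provided that \<open>\<integral> (1 + 4 t) powr (- d/2) U(dt)\<close> is finite.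
  This is where transience enters. The integral equals the expected time integral of
  \<open>exp (- |X\<^sub>t|\<^sup>2)\<close>, because a Gaussian function of Brownian motion at time \<open>s\<close> has mean
  \<open>(1 + 4 s) powr (- d/2)\<close>. If it were infinite, a second moment argument would show that \<open>X\<close> visits a
  fixed ball at arbitrarily large integer times with positive probability
  (lemmas \<open>transient_imp_bounded_partial_sums\<close> and \<open>transient_imp_green_finite\<close>). The second moment
  needs only the joint law of two values of \<open>X\<close>; it is obtained by conditioning on a dyadic
  discretisation of the subordinator and passing to the limit along the continuous paths of \<open>B\<close>.
\<close>

section \<open>Elementary integrals and bounds\<close>

lemma has_bochner_integral_power_exp:
  fixes l :: real
  assumes "l > 0"
  shows "has_bochner_integral lborel (\<lambda>t. t ^ k * exp (- (l * t)) * indicator {0..} t) (fact k / l ^ Suc k)"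
proof -
  have 1: "has_bochner_integral lborel (\<lambda>x::real. x ^ k * exp (- x) * indicator {0..} x) (fact k)"
  proof (rule has_bochner_integral_nn_integral)
    have "(\<integral>\<^sup>+ x. ennreal (x ^ k * exp (- x) * indicator {0..} x) \<partial>lborel) =
        (\<integral>\<^sup>+ x. ennreal (x ^ k * exp (- x)) * indicator {0..} x \<partial>lborel)"
      by (intro nn_integral_cong) (auto split: split_indicator)
    also have "\<dots> = ennreal (fact k)" using nn_intergal_power_times_exp_Ici[of k] by simp
    finally show "(\<integral>\<^sup>+ x. ennreal (x ^ k * exp (- x) * indicator {0..} x) \<partial>lborel) = ennreal (fact k)" .
  qed (auto split: split_indicator)
  have 2: "has_bochner_integral lborel (\<lambda>x::real. (0 + l * x) ^ k * exp (- (0 + l * x)) * indicator {0..} (0 + l * x)) (fact k /\<^sub>R \<bar>l\<bar>)"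
    using lborel_has_bochner_integral_real_affine_iff[of l "\<lambda>x. x ^ k * exp (- x) * indicator {0..} x" "fact k" 0] 1 assms by simp
  have 3: "has_bochner_integral lborel (\<lambda>x::real. (1 / l ^ k) * ((0 + l * x) ^ k * exp (- (0 + l * x)) * indicator {0..} (0 + l * x))) ((1 / l ^ k) * (fact k /\<^sub>R \<bar>l\<bar>))"
    by (rule has_bochner_integral_mult_right) (rule 2)
  have 4: "(1 / l ^ k) * ((0 + l * x) ^ k * exp (- (0 + l * x)) * indicator {0..} (0 + l * x)) =
     x ^ k * exp (- l * x) * indicator {0..} x" for x :: real
    using assms by (auto simp: power_mult_distrib zero_le_mult_iff split: split_indicator)
  show ?thesis using 3 assms unfolding 4 by (simp add: divide_inverse mult_ac)
qed

text \<open>At \<open>y = \<rho> / t\<close> this bounds the heat kernel, divided by \<open>t\<^sup>2\<close>, by a power of \<open>\<rho>\<close> uniformly in \<open>t\<close>.\<close>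

lemma powr_times_exp_bounded:
  fixes p :: real
  assumes "p > 0"
  obtains K where "K > 0" "\<And>y. y > 0 \<Longrightarrow> y powr p * exp (- y / 4) \<le> K"
proof
  show "exp (p * ln (4 * p)) > 0" by simp
  fix y :: real assume y: "y > 0"
  have "ln (y / (4 * p)) \<le> y / (4 * p) - 1" using y assms by (intro ln_le_minus_one) auto
  then have "p * (ln y - ln (4 * p)) \<le> p * (y / (4 * p) - 1)"
    using y assms by (simp add: ln_div)
  also have "\<dots> \<le> y / 4" using assms by (simp add: field_simps)
  finally have "p * ln y - y / 4 \<le> p * ln (4 * p)" by (simp add: algebra_simps)
  then show "y powr p * exp (- y / 4) \<le> exp (p * ln (4 * p))"
    using y by (simp add: powr_def mult_exp_exp)
qed

text \<open>The quadratic error makes it possible to differentiate a Laplace transform under the integral sign.\<close>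

lemma abs_exp_minus_linear_le:
  fixes x :: real
  shows "\<bar>exp x - 1 - x\<bar> \<le> x\<^sup>2 * exp \<bar>x\<bar>"
proof -
  have "exp x - 1 - x \<ge> 0" using exp_ge_add_one_self[of x] by linarith
  moreover have "exp x - 1 - x \<le> x\<^sup>2 * exp \<bar>x\<bar>"
  proof -
    obtain t where t: "\<bar>t\<bar> \<le> \<bar>x\<bar>" "exp x = (\<Sum>m<2. x ^ m / fact m) + exp t / fact 2 * x ^ 2"
      using Maclaurin_exp_le[of x 2] by blast
    have "exp t \<le> exp \<bar>x\<bar>" using t(1) by simp
    moreover have "0 < exp \<bar>x\<bar>" by simp
    ultimately have "exp t / 2 \<le> exp \<bar>x\<bar>" by linarith
    then have "exp t / 2 * x\<^sup>2 \<le> exp \<bar>x\<bar> * x\<^sup>2" by (intro mult_right_mono) auto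
    then show ?thesis using t(2) by (simp add: numeral_2_eq_2 mult_ac)
  qed
  ultimately show ?thesis by simp
qed

text \<open>The parameter \<open>\<rho>\<close> is the squared distance.\<close>

definition heat_kernel :: "real \<Rightarrow> real \<Rightarrow> real \<Rightarrow> real" where
  "heat_kernel d \<rho> t = (4 * pi * t) powr (- d / 2) * exp (- \<rho> / (4 * t))"

lemma heat_kernel_nonneg: "0 \<le> heat_kernel d \<rho> t"
  by (simp add: heat_kernel_def)

lemma heat_kernel_measurable [measurable]: "heat_kernel d \<rho> \<in> borel_measurable borel"
  unfolding heat_kernel_def by measurable

lemma has_bochner_integral_powr_tail:
  fixes q \<rho> :: real
  assumes "q < - 1" "0 < \<rho>"
  shows "has_bochner_integral lborel (\<lambda>t. t powr q * indicator {\<rho>..} t) (\<rho> powr (q + 1) / (- q - 1))"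
proof (rule has_bochner_integral_nn_integral)
  have lim: "((\<lambda>t::real. t powr (q + 1) / (q + 1)) \<longlongrightarrow> 0) at_top"
  proof -
    have "((\<lambda>t::real. t powr (q + 1)) \<longlongrightarrow> 0) at_top"
      by (rule tendsto_neg_powr) (use assms in \<open>auto intro: filterlim_ident\<close>)
    from tendsto_divide[OF this tendsto_const[of "q+1"]] show ?thesis using assms by simp
  qed
  have "(\<integral>\<^sup>+ t. ennreal (t powr q * indicator {\<rho>..} t) \<partial>lborel) =
      (\<integral>\<^sup>+ t. ennreal (t powr q) * indicator {\<rho>..} t \<partial>lborel)"
    by (intro nn_integral_cong) (auto split: split_indicator)
  also have "\<dots> = ennreal (0 - \<rho> powr (q + 1) / (q + 1))"
  proof (rule nn_integral_FTC_atLeast[OF _ _ _ lim])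
    fix x assume "\<rho> \<le> x"
    then show "((\<lambda>t. t powr (q + 1) / (q + 1)) has_real_derivative x powr q) (at x)"
      using assms by (auto intro!: derivative_eq_intros)
  qed auto
  also have "0 - \<rho> powr (q + 1) / (q + 1) = \<rho> powr (q + 1) / (- q - 1)"
    using assms by (simp add: field_simps)
  finally show "(\<integral>\<^sup>+ t. ennreal (t powr q * indicator {\<rho>..} t) \<partial>lborel) = ennreal (\<rho> powr (q + 1) / (- q - 1))" .
qed (use assms in \<open>auto intro!: divide_nonneg_nonneg\<close>)

section \<open>Laplace transforms of decreasing densities\<close>

locale decreasing_density =
  fixes v :: "real \<Rightarrow> real"
  assumes v_pos: "0 < t \<Longrightarrow> 0 < v t"
    and v_zero: "t \<le> 0 \<Longrightarrow> v t = 0"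
    and v_antimono: "0 < s \<Longrightarrow> s \<le> t \<Longrightarrow> v t \<le> v s"
    and laplace_integrable: "0 < l \<Longrightarrow> integrable lborel (\<lambda>t. exp (- (l * t)) * v t)"
begin

definition laplace :: "real \<Rightarrow> real" where
  "laplace l = (\<integral>t. exp (- (l * t)) * v t \<partial>lborel)"

definition moment :: "real \<Rightarrow> real" where
  "moment l = (\<integral>t. t * exp (- (l * t)) * v t \<partial>lborel)"

lemma v_nonneg: "0 \<le> v t"
  using v_pos[of t] v_zero[of t] by (cases "t > 0") auto

lemma tv_nonneg: "0 \<le> t * v t"
  using v_nonneg[of t] v_zero[of t] by (cases "t > 0") auto

lemma v_measurable [measurable]: "v \<in> borel_measurable borel"
proof -
  have "(\<lambda>t. exp (- 1 * t) * v t) \<in> borel_measurable borel"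
    using laplace_integrable[of 1] by (simp add: borel_measurable_integrable)
  then have "(\<lambda>t. exp t * (exp (- 1 * t) * v t)) \<in> borel_measurable borel" by measurable
  also have "(\<lambda>t. exp t * (exp (- 1 * t) * v t)) = v" by (simp flip: exp_add mult.assoc)
  finally show ?thesis .
qed

text \<open>A polynomial factor costs only half of the exponential decay.\<close>

lemma moment2_integrable:
  assumes "0 < l" shows "integrable lborel (\<lambda>t. t\<^sup>2 * exp (- (l * t)) * v t)"
proof (rule Bochner_Integration.integrable_bound)
  show "integrable lborel (\<lambda>t. 8 / l\<^sup>2 * (exp (- ((l/2) * t)) * v t))"
    using laplace_integrable[of "l/2"] assms by (intro integrable_mult_right) auto
  show "AE t in lborel. norm (t\<^sup>2 * exp (- (l * t)) * v t) \<le> norm (8 / l\<^sup>2 * (exp (- ((l / 2) * t)) * v t))"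
  proof (rule AE_I2)
    fix t :: real
    have "t\<^sup>2 * exp (- (l * t)) \<le> 8 / l\<^sup>2 * exp (- ((l / 2) * t))" if "t > 0"
    proof -
      have "(l * t / 2)\<^sup>2 / 2 \<le> exp (l * t / 2)"
        using exp_lower_Taylor_quadratic[of "l * t / 2"] mult_pos_pos[OF assms that] by linarith
      then have "t\<^sup>2 \<le> 8 / l\<^sup>2 * exp (l * t / 2)" using assms by (simp add: field_simps power2_eq_square)
      then have "t\<^sup>2 * exp (- (l * t)) \<le> 8 / l\<^sup>2 * exp (l * t / 2) * exp (- (l * t))" by (rule mult_right_mono) simp
      also have "\<dots> = 8 / l\<^sup>2 * exp (- ((l / 2) * t))" by (simp add: field_simps flip: exp_add)
      finally show ?thesis .
    qed
    from mult_right_mono[OF this v_nonneg[of t]]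
    show "norm (t\<^sup>2 * exp (- (l * t)) * v t) \<le> norm (8 / l\<^sup>2 * (exp (- ((l / 2) * t)) * v t))"
      using v_zero[of t] v_nonneg[of t] by (cases "t > 0") (auto simp: abs_mult)
  qed
qed measurable

lemma moment_integrable:
  assumes "0 < l" shows "integrable lborel (\<lambda>t. t * exp (- (l * t)) * v t)"
proof (rule Bochner_Integration.integrable_bound)
  show "integrable lborel (\<lambda>t. exp (- (l * t)) * v t + t\<^sup>2 * exp (- (l * t)) * v t)"
    using laplace_integrable[of l] moment2_integrable[of l] assms by (intro Bochner_Integration.integrable_add) auto
  show "AE t in lborel. norm (t * exp (- (l * t)) * v t) \<le> norm (exp (- (l * t)) * v t + t\<^sup>2 * exp (- (l * t)) * v t)"
  proof (rule AE_I2)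
    fix t :: real
    have "0 \<le> (\<bar>t\<bar> - 1)\<^sup>2" by simp
    then have "2 * \<bar>t\<bar> \<le> 1 + t\<^sup>2" by (simp add: power2_diff)
    then have "\<bar>t\<bar> \<le> 1 + t\<^sup>2" by linarith
    from mult_right_mono[OF this, of "exp (- (l * t)) * v t"]
    show "norm (t * exp (- (l * t)) * v t) \<le> norm (exp (- (l * t)) * v t + t\<^sup>2 * exp (- (l * t)) * v t)"
      using v_nonneg[of t] by (simp add: abs_mult algebra_simps)
  qed
qed measurable

lemma moment_antimono:
  assumes "0 < l" "l \<le> k" shows "moment k \<le> moment l"
  unfolding moment_def
proof (rule integral_mono)
  fix t
  have "(t * v t) * exp (- (k * t)) \<le> (t * v t) * exp (- (l * t))"
    using assms v_zero[of t] tv_nonneg[of t] v_nonneg[of t]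
    by (cases "t > 0") (auto intro!: mult_left_mono mult_right_mono)
  then show "t * exp (- (k * t)) * v t \<le> t * exp (- (l * t)) * v t" by (simp add: mult_ac)
qed (use assms moment_integrable in auto)

lemma laplace_antimono:
  assumes "0 < l" "l \<le> k" shows "laplace k \<le> laplace l"
  unfolding laplace_def
proof (rule integral_mono)
  fix t
  show "exp (- (k * t)) * v t \<le> exp (- (l * t)) * v t"
    using assms v_zero[of t] v_nonneg[of t]
    by (cases "t > 0") (auto intro!: mult_right_mono)
qed (use assms laplace_integrable in auto)

text \<open>On \<open>[t/2, t]\<close> the density is at least \<open>v t\<close>, and the weight \<open>s * exp (- s/t)\<close> is at least \<open>t / (2 e)\<close>.\<close>

lemma density_le_moment:
  assumes "0 < t" shows "t\<^sup>2 * v t \<le> 4 * exp 1 * moment (1 / t)"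
proof -
  have "(\<integral>s. t / 2 * exp (- 1) * v t * indicator {t/2..t} s \<partial>lborel) \<le> moment (1 / t)"
    unfolding moment_def
  proof (rule integral_mono)
    show "integrable lborel (\<lambda>s. s * exp (- ((1 / t) * s)) * v s)" using assms by (intro moment_integrable) auto
    fix s
    show "t / 2 * exp (- 1) * v t * indicator {t/2..t} s \<le> s * exp (- ((1 / t) * s)) * v s"
    proof (cases "s \<in> {t/2..t}")
      case True
      then have "t / 2 * exp (- 1) * v t \<le> s * exp (- ((1 / t) * s)) * v s"
        using assms by (intro mult_mono v_antimono mult_nonneg_nonneg v_nonneg) (auto simp: field_simps)
      then show ?thesis using True by simp
    next
      case False
      have "0 \<le> s * v s * exp (- ((1 / t) * s))" using tv_nonneg[of s] by simp
      then show ?thesis using False by (simp add: mult_ac)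
    qed
  qed (use assms in \<open>intro integrable_mult_right integrable_real_indicator; simp\<close>)
  also have "(\<integral>s. t / 2 * exp (- 1) * v t * indicator {t/2..t} s \<partial>lborel) = t\<^sup>2 / 4 * exp (- 1) * v t"
    using assms by (simp add: power2_eq_square)
  finally show ?thesis by (simp add: exp_minus field_simps)
qed

lemma moment_pos: assumes "0 < l" shows "0 < moment l"
proof -
  have "0 < (1 / l)\<^sup>2 * v (1 / l)" using assms v_pos[of "1/l"] by simp
  also have "\<dots> \<le> 4 * exp 1 * moment l" using density_le_moment[of "1 / l"] assms by simp
  finally show ?thesis by (simp add: zero_less_mult_iff)
qed

text \<open>The factor \<open>1 - l t\<close> changes sign at \<open>t = 1/l\<close> from positive to negative, so against the decreasing
  \<open>v\<close> it integrates to at least what it gives against the constant \<open>v (1/l)\<close>; the latter is \<open>0\<close>. In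
  terms of \<open>\<phi> = 1 / laplace\<close> the inequality is \<open>l * \<phi>' l \<le> \<phi> l\<close>.\<close>

lemma times_moment_le_laplace:
  assumes "0 < l" shows "l * moment l \<le> laplace l"
proof -
  have I: "has_bochner_integral lborel (\<lambda>t. v (1 / l) * (t ^ 0 * exp (- (l * t)) * indicator {0..} t - l * (t ^ 1 * exp (- (l * t)) * indicator {0..} t)))
     (v (1 / l) * (fact 0 / l ^ Suc 0 - l * (fact 1 / l ^ Suc 1)))"
    using assms by (intro has_bochner_integral_mult_right has_bochner_integral_diff has_bochner_integral_power_exp)
  have "0 = v (1 / l) * (fact 0 / l ^ Suc 0 - l * (fact 1 / l ^ Suc 1))" using assms by simp
  also have "\<dots> = (\<integral>t. v (1 / l) * (t ^ 0 * exp (- (l * t)) * indicator {0..} t - l * (t ^ 1 * exp (- (l * t)) * indicator {0..} t)) \<partial>lborel)"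
    using has_bochner_integral_integral_eq[OF I] by (rule sym)
  also have "\<dots> \<le> (\<integral>t. exp (- (l * t)) * v t - l * (t * exp (- (l * t)) * v t) \<partial>lborel)"
  proof (rule integral_mono_AE)
    show "integrable lborel (\<lambda>t. v (1 / l) * (t ^ 0 * exp (- (l * t)) * indicator {0..} t - l * (t ^ 1 * exp (- (l * t)) * indicator {0..} t)))"
      using I by (simp add: has_bochner_integral_iff)
    show "integrable lborel (\<lambda>t. exp (- (l * t)) * v t - l * (t * exp (- (l * t)) * v t))"
      using assms by (intro Bochner_Integration.integrable_diff integrable_mult_right laplace_integrable moment_integrable)
    show "AE t in lborel. v (1 / l) * (t ^ 0 * exp (- (l * t)) * indicator {0..} t - l * (t ^ 1 * exp (- (l * t)) * indicator {0..} t))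
       \<le> exp (- (l * t)) * v t - l * (t * exp (- (l * t)) * v t)"
      using AE_lborel_singleton[of 0]
    proof eventually_elim
      fix t :: real assume "t \<noteq> 0"
      consider "t < 0" | "0 < t" "t \<le> 1 / l" | "1 / l < t" using \<open>t \<noteq> 0\<close> by linarith
      then show "v (1 / l) * (t ^ 0 * exp (- (l * t)) * indicator {0..} t - l * (t ^ 1 * exp (- (l * t)) * indicator {0..} t))
       \<le> exp (- (l * t)) * v t - l * (t * exp (- (l * t)) * v t)"
      proof cases
        case 1 then show ?thesis using v_zero[of t] by simp
      next
        case 2
        have "0 \<le> (1 - l * t) * (v t - v (1 / l))"
          using 2 assms v_antimono[of t "1/l"] by (intro mult_nonneg_nonneg) (auto simp: field_simps)
        then have "0 \<le> (1 - l * t) * (v t - v (1 / l)) * exp (- (l * t))" by simp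
        then show ?thesis using 2 by (simp add: algebra_simps)
      next
        case 3
        have "t > 0" using 3 assms by (meson less_trans zero_less_divide_1_iff)
        have "0 \<le> (1 - l * t) * (v t - v (1 / l))"
          using 3 assms v_antimono[of "1/l" t] by (intro mult_nonpos_nonpos) (auto simp: field_simps)
        then have "0 \<le> (1 - l * t) * (v t - v (1 / l)) * exp (- (l * t))" by simp
        then show ?thesis using \<open>t > 0\<close> by (simp add: algebra_simps)
      qed
    qed
  qed
  also have "\<dots> = laplace l - l * moment l"
    unfolding laplace_def moment_def
    by (rule has_bochner_integral_integral_eq,
        intro has_bochner_integral_diff has_bochner_integral_mult_right
          has_bochner_integral_integrable laplace_integrable moment_integrable assms)
  finally show ?thesis by simp
qed

lemma laplace_pos: assumes "0 < l" shows "0 < laplace l"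
  using times_moment_le_laplace[OF assms] mult_pos_pos[OF assms moment_pos[OF assms]] by linarith

lemma laplace_has_derivative:
  assumes l: "0 < l" shows "(laplace has_real_derivative - moment l) (at l)"
proof -
  define C where "C = (\<integral>t. t\<^sup>2 * exp (- ((l/2) * t)) * v t \<partial>lborel)"
  have est: "\<bar>laplace (l + h) - laplace l + h * moment l\<bar> \<le> C * h\<^sup>2" if h: "\<bar>h\<bar> \<le> l / 2" for h
  proof -
    have lh: "l + h > 0" using h l by linarith
    have "\<bar>laplace (l + h) - laplace l + h * moment l\<bar> = \<bar>\<integral>t. exp (- ((l + h) * t)) * v t - exp (- (l * t)) * v t + h * (t * exp (- (l * t)) * v t) \<partial>lborel\<bar>"
      unfolding laplace_def moment_def
      by (rule arg_cong[where f = abs], rule has_bochner_integral_integral_eq[symmetric],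
          intro has_bochner_integral_add has_bochner_integral_diff has_bochner_integral_mult_right
            has_bochner_integral_integrable laplace_integrable moment_integrable l lh)
    also have "\<dots> \<le> (\<integral>t. \<bar>exp (- ((l + h) * t)) * v t - exp (- (l * t)) * v t + h * (t * exp (- (l * t)) * v t)\<bar> \<partial>lborel)"
      by (rule integral_abs_bound)
    also have "\<dots> \<le> (\<integral>t. h\<^sup>2 * (t\<^sup>2 * exp (- ((l/2) * t)) * v t) \<partial>lborel)"
    proof (rule integral_mono)
      show "integrable lborel (\<lambda>t. \<bar>exp (- ((l + h) * t)) * v t - exp (- (l * t)) * v t + h * (t * exp (- (l * t)) * v t)\<bar>)"
        by (intro integrable_abs Bochner_Integration.integrable_add Bochner_Integration.integrable_diff integrable_mult_right
           laplace_integrable moment_integrable l lh)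
      show "integrable lborel (\<lambda>t. h\<^sup>2 * (t\<^sup>2 * exp (- ((l/2) * t)) * v t))"
        using l by (intro integrable_mult_right moment2_integrable) auto
      fix t
      show "\<bar>exp (- ((l + h) * t)) * v t - exp (- (l * t)) * v t + h * (t * exp (- (l * t)) * v t)\<bar>
          \<le> h\<^sup>2 * (t\<^sup>2 * exp (- ((l/2) * t)) * v t)"
      proof (cases "t > 0")
        case True
        have "exp (- ((l + h) * t)) * v t - exp (- (l * t)) * v t + h * (t * exp (- (l * t)) * v t)
           = (exp (- h * t) - 1 - (- h * t)) * (exp (- (l * t)) * v t)"
          by (simp add: algebra_simps flip: exp_add)
        also have "\<bar>\<dots>\<bar> = \<bar>exp (- h * t) - 1 - (- h * t)\<bar> * (exp (- (l * t)) * v t)"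
          using v_nonneg by (simp add: abs_mult)
        also have "\<dots> \<le> ((- h * t)\<^sup>2 * exp \<bar>- h * t\<bar>) * (exp (- (l * t)) * v t)"
          using v_nonneg by (intro mult_right_mono abs_exp_minus_linear_le) auto
        also have "\<dots> = h\<^sup>2 * (t\<^sup>2 * exp (\<bar>h\<bar> * t - l * t) * v t)"
          using True by (simp add: power_mult_distrib abs_mult exp_diff exp_minus field_simps)
        also have "\<dots> \<le> h\<^sup>2 * (t\<^sup>2 * exp (- ((l/2) * t)) * v t)"
        proof -
          have "\<bar>h\<bar> * t \<le> l / 2 * t" using h True by (intro mult_right_mono) auto
          then show ?thesis using v_nonneg by (intro mult_left_mono mult_right_mono) auto
        qed
        finally show ?thesis .
      next
        case False then show ?thesis by (simp add: v_zero)
      qed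
    qed
    also have "\<dots> = C * h\<^sup>2" unfolding C_def by simp
    finally show ?thesis .
  qed
  have "((\<lambda>h. (laplace (l + h) - laplace l) / h) \<longlongrightarrow> - moment l) (at 0)"
  proof (rule LIM_zero_cancel, rule Lim_null_comparison)
    show "((\<lambda>h. C * \<bar>h\<bar>) \<longlongrightarrow> 0) (at 0)" by (auto intro!: tendsto_eq_intros)
    have "\<forall>\<^sub>F h in at 0. \<bar>h\<bar> \<le> l / 2 \<and> h \<noteq> 0"
      unfolding eventually_at using l by (intro exI[of _ "l/2"]) auto
    then show "\<forall>\<^sub>F h in at 0. norm ((laplace (l + h) - laplace l) / h - - moment l) \<le> C * \<bar>h\<bar>"
    proof eventually_elim
      fix h :: real assume h: "\<bar>h\<bar> \<le> l / 2 \<and> h \<noteq> 0"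
      have "norm ((laplace (l + h) - laplace l) / h - - moment l) = \<bar>laplace (l + h) - laplace l + h * moment l\<bar> / \<bar>h\<bar>"
        using h by (simp add: field_simps flip: abs_divide)
      also have "\<dots> \<le> C * h\<^sup>2 / \<bar>h\<bar>" using est h by (intro divide_right_mono) auto
      also have "\<dots> = C * \<bar>h\<bar>" using h by (simp add: field_simps power2_eq_square flip: abs_mult)
      finally show "norm ((laplace (l + h) - laplace l) / h - - moment l) \<le> C * \<bar>h\<bar>" .
    qed
  qed
  then show ?thesis by (simp add: DERIV_def)
qed

text \<open>Times \<open>s \<le> \<epsilon> t\<close> are charged to \<open>moment (1 / (\<epsilon> t))\<close>, where their weight is smaller by at most the
  factor \<open>e\<close>. For later times the density is at most \<open>v (\<epsilon> t)\<close>, and the weight has total mass \<open>t\<^sup>2\<close>.\<close>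

lemma moment_le_density:
  assumes "0 < t" "0 < \<epsilon>" "\<epsilon> \<le> 1"
  shows "moment (1 / t) \<le> exp 1 * moment (1 / (\<epsilon> * t)) + t\<^sup>2 * v (\<epsilon> * t)"
proof -
  have I: "has_bochner_integral lborel
     (\<lambda>s. exp 1 * (s * exp (- (1 / (\<epsilon> * t) * s)) * v s) + v (\<epsilon> * t) * (s ^ 1 * exp (- (1 / t * s)) * indicator {0..} s))
     (exp 1 * moment (1 / (\<epsilon> * t)) + v (\<epsilon> * t) * (fact 1 / (1 / t) ^ Suc 1))"
    unfolding moment_def using assms
    by (intro has_bochner_integral_add has_bochner_integral_mult_right has_bochner_integral_power_exp
        has_bochner_integral_integrable moment_integrable) auto
  have "moment (1 / t) \<le> exp 1 * moment (1 / (\<epsilon> * t)) + v (\<epsilon> * t) * (fact 1 / (1 / t) ^ Suc 1)"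
    unfolding moment_def[of "1 / t"] has_bochner_integral_integral_eq[OF I, symmetric]
  proof (rule integral_mono)
    show "integrable lborel (\<lambda>s. s * exp (- (1 / t * s)) * v s)"
      using assms by (intro moment_integrable) auto
    show "integrable lborel (\<lambda>s. exp 1 * (s * exp (- (1 / (\<epsilon> * t) * s)) * v s) + v (\<epsilon> * t) * (s ^ 1 * exp (- (1 / t * s)) * indicator {0..} s))"
      using I by (rule integrable.intros)
    fix s :: real
    consider "s \<le> 0" | "0 < s" "s \<le> \<epsilon> * t" | "0 < s" "\<epsilon> * t < s" by linarith
    then show "s * exp (- (1 / t * s)) * v s \<le> exp 1 * (s * exp (- (1 / (\<epsilon> * t) * s)) * v s) + v (\<epsilon> * t) * (s ^ 1 * exp (- (1 / t * s)) * indicator {0..} s)"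
    proof cases
      case 1 then show ?thesis using assms v_nonneg[of "\<epsilon> * t"] by (cases "s = 0") (auto simp: v_zero)
    next
      case 2
      have "exp (- (1 / t * s)) \<le> exp (1 - 1 / (\<epsilon> * t) * s)"
      proof -
        have "1 / (\<epsilon> * t) * s \<le> 1" using 2 assms by (simp add: field_simps)
        moreover have "0 \<le> 1 / t * s" using 2 assms by simp
        ultimately show ?thesis by simp
      qed
      then have "exp (- (1 / t * s)) \<le> exp 1 * exp (- (1 / (\<epsilon> * t) * s))"
        by (simp flip: exp_add)
      from mult_right_mono[OF this tv_nonneg[of s]]
      have "s * exp (- (1 / t * s)) * v s \<le> exp 1 * (s * exp (- (1 / (\<epsilon> * t) * s)) * v s)"
        by (simp add: mult_ac)
      then show ?thesis using v_nonneg[of "\<epsilon> * t"] 2 by (auto intro!: add_increasing2)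
    next
      case 3
      have "v s \<le> v (\<epsilon> * t)" using 3 assms by (intro v_antimono) auto
      then have "v s * (s * exp (- (1 / t * s))) \<le> v (\<epsilon> * t) * (s * exp (- (1 / t * s)))"
        using 3 by (intro mult_right_mono) auto
      also have "v (\<epsilon> * t) * (s * exp (- (1 / t * s))) = v (\<epsilon> * t) * (s ^ 1 * exp (- (1 / t * s)) * indicator {0..} s)"
        using 3 by simp
      finally have "s * exp (- (1 / t * s)) * v s \<le> v (\<epsilon> * t) * (s ^ 1 * exp (- (1 / t * s)) * indicator {0..} s)"
        by (simp only: mult_ac)
      moreover have "0 \<le> exp 1 * (s * exp (- (1 / (\<epsilon> * t) * s)) * v s)"
        using 3 v_nonneg[of s] by simp
      ultimately show ?thesis by linarith
    qed
  qed
  then show ?thesis using assms by (simp add: power2_eq_square mult_ac)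
qed

text \<open>When \<open>moment\<close> decays at a power rate, the first term of the previous bound can be absorbed on the
  left by choosing \<open>\<epsilon>\<close> small. This is the converse of \<open>density_le_moment\<close> for short times.\<close>

lemma moment_le_density_scaling:
  assumes "0 < \<sigma>" "0 < \<delta>" "0 < l\<^sub>0"
    and scal: "\<And>x l. 1 \<le> x \<Longrightarrow> l\<^sub>0 \<le> l \<Longrightarrow> moment (l * x) \<le> \<sigma> * x powr (- \<delta>) * moment l"
  obtains c t\<^sub>1 where "0 < c" "0 < t\<^sub>1" "\<And>s. 0 < s \<Longrightarrow> s \<le> t\<^sub>1 \<Longrightarrow> c * moment (1 / s) \<le> s\<^sup>2 * v s"
proof -
  (* With this choice the absorbed term is at most half of moment (1 / t). *)
  define \<epsilon> where "\<epsilon> = min 1 ((2 * exp 1 * \<sigma>) powr (- 1 / \<delta>))"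
  have \<epsilon>: "0 < \<epsilon>" "\<epsilon> \<le> 1" using assms by (auto simp: \<epsilon>_def)
  have "\<epsilon> powr \<delta> \<le> ((2 * exp 1 * \<sigma>) powr (- 1 / \<delta>)) powr \<delta>"
    using \<epsilon> assms by (intro powr_mono2) (auto simp: \<epsilon>_def)
  also have "\<dots> = 1 / (2 * exp 1 * \<sigma>)"
    unfolding powr_powr using assms by (simp add: powr_minus_divide)
  finally have \<epsilon>\<delta>: "exp 1 * (\<sigma> * \<epsilon> powr \<delta>) \<le> 1 / 2" using assms by (simp add: field_simps)
  show thesis
  proof
    show "0 < \<epsilon>\<^sup>2 / 2" using \<epsilon> by simp
    show "0 < \<epsilon> / l\<^sub>0" using \<epsilon> assms by simp
    fix s :: real assume s: "0 < s" "s \<le> \<epsilon> / l\<^sub>0"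
    define t where "t = s / \<epsilon>"
    have t: "0 < t" "\<epsilon> * t = s" using s \<epsilon> by (auto simp: t_def)
    have l: "l\<^sub>0 \<le> 1 / t" using s \<epsilon> assms by (simp add: t_def field_simps)
    have "moment (1 / s) = moment (1 / t * (1 / \<epsilon>))" using t by (simp add: mult.commute flip: t(2))
    also have "\<dots> \<le> \<sigma> * (1 / \<epsilon>) powr (- \<delta>) * moment (1 / t)" using \<epsilon> l by (intro scal) auto
    also have "(1 / \<epsilon>) powr (- \<delta>) = \<epsilon> powr \<delta>" using \<epsilon> by (simp add: powr_divide powr_minus)
    finally have "exp 1 * moment (1 / s) \<le> (exp 1 * (\<sigma> * \<epsilon> powr \<delta>)) * moment (1 / t)" by simp
    also have "\<dots> \<le> 1 / 2 * moment (1 / t)" using \<epsilon>\<delta> moment_pos[of "1/t"] t by (intro mult_right_mono) auto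
    finally have "moment (1 / t) \<le> 1 / 2 * moment (1 / t) + t\<^sup>2 * v s"
      using moment_le_density[OF t(1) \<epsilon>] t by simp
    moreover have "moment (1 / s) \<le> moment (1 / t)" using t s \<epsilon> by (intro moment_antimono) (auto simp: t_def field_simps)
    ultimately have "moment (1 / s) / 2 \<le> t\<^sup>2 * v s" by linarith
    then have "\<epsilon>\<^sup>2 * (moment (1 / s) / 2) \<le> \<epsilon>\<^sup>2 * (t\<^sup>2 * v s)" by (intro mult_left_mono) auto
    also have "\<dots> = s\<^sup>2 * v s" using t by (simp add: power_mult_distrib flip: mult.assoc t(2))
    finally show "\<epsilon>\<^sup>2 / 2 * moment (1 / s) \<le> s\<^sup>2 * v s" by simp
  qed
qed

text \<open>For \<open>\<phi> = 1 / laplace\<close> the assumption reads \<open>\<phi>' (l x) \<le> \<sigma> x powr (- \<delta>) \<phi>' l\<close> and the conclusion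
  \<open>\<phi> (l x) \<le> C x powr (1 - \<delta>) \<phi> l\<close>: it is the integrated form, where \<open>l * \<phi>' l \<le> \<phi> l\<close> turns
  the derivative at \<open>l\<close> back into a value.\<close>

lemma laplace_growth:
  assumes "\<delta> < 1" "0 < l\<^sub>0" "0 < \<sigma>"
    and scal: "\<And>x l. 1 \<le> x \<Longrightarrow> l\<^sub>0 \<le> l \<Longrightarrow> moment (l * x) / (laplace (l * x))\<^sup>2 \<le> \<sigma> * x powr (- \<delta>) * (moment l / (laplace l)\<^sup>2)"
    and "1 \<le> x" "l\<^sub>0 \<le> l"
  shows "laplace l \<le> max 1 (\<sigma> / (1 - \<delta>)) * x powr (1 - \<delta>) * laplace (l * x)"
proof -
  define C where "C = max 1 (\<sigma> / (1 - \<delta>))"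
  have l: "0 < l" using assms by simp
  (* By the choice of C, the difference of the two sides decreases in x and is nonpositive at x = 1. *)
  define \<psi> where "\<psi> y = 1 / laplace (l * y) - C / laplace l * y powr (1 - \<delta>)" for y
  have "\<psi> x \<le> \<psi> 1"
  proof (rule DERIV_nonpos_imp_nonincreasing[where f = \<psi>])
    fix y :: real assume y: "1 \<le> y" "y \<le> x"
    have ly: "0 < l * y" using l y by simp
    have D: "(\<psi> has_real_derivative l * (moment (l * y) / (laplace (l * y))\<^sup>2) - C / laplace l * ((1 - \<delta>) * y powr (- \<delta>))) (at y)"
    proof -
      have "((\<lambda>y. laplace (l * y)) has_real_derivative - moment (l * y) * l) (at y)"
        using DERIV_chain2[of laplace "- moment (l * y)" "\<lambda>y. l * y" y l UNIV] laplace_has_derivative[OF ly]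
        by (auto intro!: derivative_eq_intros)
      then show ?thesis unfolding \<psi>_def using laplace_pos[OF ly] y laplace_pos[OF l]
        by (auto intro!: derivative_eq_intros simp: power2_eq_square field_simps)
    qed
    have "l * (moment (l * y) / (laplace (l * y))\<^sup>2) \<le> l * (\<sigma> * y powr (- \<delta>) * (moment l / (laplace l)\<^sup>2))"
      using scal[OF y(1) assms(6)] l by (intro mult_left_mono) auto
    also have "\<dots> = \<sigma> * y powr (- \<delta>) * ((l * moment l) / (laplace l)\<^sup>2)" by simp
    also have "\<dots> \<le> \<sigma> * y powr (- \<delta>) * (laplace l / (laplace l)\<^sup>2)"
      using times_moment_le_laplace[OF l] assms by (intro mult_left_mono divide_right_mono) auto
    also have "\<dots> = \<sigma> * (y powr (- \<delta>) / laplace l)" using laplace_pos[OF l] by (simp add: power2_eq_square)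
    also have "\<dots> \<le> (C * (1 - \<delta>)) * (y powr (- \<delta>) / laplace l)"
    proof (intro mult_right_mono)
      have "\<sigma> / (1 - \<delta>) \<le> C" by (simp add: C_def)
      then show "\<sigma> \<le> C * (1 - \<delta>)" using assms by (simp add: field_simps)
    qed (use laplace_pos[OF l] in auto)
    finally have "l * (moment (l * y) / (laplace (l * y))\<^sup>2) - C / laplace l * ((1 - \<delta>) * y powr (- \<delta>)) \<le> 0" by simp
    with D show "\<exists>z. (\<psi> has_real_derivative z) (at y) \<and> z \<le> 0" by blast
  qed (use assms in auto)
  also have "\<psi> 1 = (1 - C) / laplace l" by (simp add: \<psi>_def diff_divide_distrib)
  also have "\<dots> \<le> 0" using laplace_pos[OF l] by (intro divide_nonpos_pos) (auto simp: C_def)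
  finally have "1 / laplace (l * x) \<le> C / laplace l * x powr (1 - \<delta>)" by (simp add: \<psi>_def)
  moreover have "0 < laplace (l * x)" using laplace_pos[of "l * x"] l assms by simp
  ultimately show ?thesis using laplace_pos[OF l] unfolding C_def[symmetric] by (simp add: field_simps)
qed

text \<open>Since \<open>moment = \<phi>' / \<phi>\<^sup>2\<close>, the lower scaling of \<open>\<phi>'\<close> contributes the exponent \<open>\<delta>'\<close> and the
  growth of \<open>\<phi>\<^sup>2\<close> the exponent \<open>2 (1 - \<delta>)\<close>.\<close>

lemma moment_scaling_lower:
  assumes "\<delta> < 1" "0 < l\<^sub>0" "0 < \<sigma>" "0 < \<sigma>'"
    and A3: "\<And>x l. 1 \<le> x \<Longrightarrow> l\<^sub>0 \<le> l \<Longrightarrow> moment (l * x) / (laplace (l * x))\<^sup>2 \<le> \<sigma> * x powr (- \<delta>) * (moment l / (laplace l)\<^sup>2)"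
    and B: "\<And>x l. 1 \<le> x \<Longrightarrow> l\<^sub>0 \<le> l \<Longrightarrow> \<sigma>' * x powr (- \<delta>') * (moment l / (laplace l)\<^sup>2) \<le> moment (l * x) / (laplace (l * x))\<^sup>2"
    and "1 \<le> x" "l\<^sub>0 \<le> l"
  shows "moment l \<le> ((max 1 (\<sigma> / (1 - \<delta>)))\<^sup>2 / \<sigma>') * x powr (\<delta>' + 2 * (1 - \<delta>)) * moment (l * x)"
proof -
  define C where "C = max 1 (\<sigma> / (1 - \<delta>))"
  have l: "0 < l" "0 < l * x" "0 < x" using assms by auto
  have "(laplace l)\<^sup>2 \<le> (C * x powr (1 - \<delta>) * laplace (l * x))\<^sup>2"
    using laplace_growth[OF assms(1-3) A3 assms(7,8)] laplace_pos[OF l(1)] unfolding C_def[symmetric]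
    by (intro power_mono) auto
  also have "\<dots> = C\<^sup>2 * x powr (2 * (1 - \<delta>)) * (laplace (l * x))\<^sup>2"
    using l by (simp add: power_mult_distrib powr_power mult.commute)
  finally have L2: "(laplace l)\<^sup>2 \<le> C\<^sup>2 * x powr (2 * (1 - \<delta>)) * (laplace (l * x))\<^sup>2" .
  have "moment l = x powr \<delta>' / \<sigma>' * (\<sigma>' * x powr (- \<delta>') * (moment l / (laplace l)\<^sup>2)) * (laplace l)\<^sup>2"
    using laplace_pos[OF l(1)] l assms by (simp add: powr_minus field_simps)
  also have "\<dots> \<le> x powr \<delta>' / \<sigma>' * (moment (l * x) / (laplace (l * x))\<^sup>2) * (C\<^sup>2 * x powr (2 * (1 - \<delta>)) * (laplace (l * x))\<^sup>2)"
    using L2 B[OF assms(7,8)] assms moment_pos[OF l(1)] moment_pos[OF l(2)]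
    by (intro mult_mono mult_left_mono mult_nonneg_nonneg divide_nonneg_nonneg) auto
  also have "\<dots> = (C\<^sup>2 / \<sigma>') * x powr (\<delta>' + 2 * (1 - \<delta>)) * moment (l * x)"
    using laplace_pos[OF l(2)] by (simp add: powr_add)
  finally show ?thesis unfolding C_def .
qed

section \<open>Two-sided bounds for the heat kernel integral\<close>

text \<open>Only times in \<open>[\<rho>/2, \<rho>]\<close> are used; there the density is at least \<open>v \<rho>\<close>.\<close>

lemma heat_integral_lower:
  assumes "0 < d" "0 < \<rho>" "integrable lborel (\<lambda>t. heat_kernel d \<rho> t * v t)"
  shows "(4 * pi) powr (- d / 2) * exp (- 1 / 2) / 2 * (\<rho> powr (1 - d / 2) * v \<rho>) \<le> (\<integral>t. heat_kernel d \<rho> t * v t \<partial>lborel)"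
proof -
  have "(\<integral>t. (4 * pi * \<rho>) powr (- d / 2) * exp (- 1 / 2) * v \<rho> * indicator {\<rho> / 2..\<rho>} t \<partial>lborel)
      \<le> (\<integral>t. heat_kernel d \<rho> t * v t \<partial>lborel)"
  proof (rule integral_mono[OF _ assms(3)])
    show "integrable lborel (\<lambda>t. (4 * pi * \<rho>) powr (- d / 2) * exp (- 1 / 2) * v \<rho> * indicator {\<rho> / 2..\<rho>} t)"
      using assms by (intro integrable_mult_right integrable_real_indicator) auto
    fix t
    show "(4 * pi * \<rho>) powr (- d / 2) * exp (- 1 / 2) * v \<rho> * indicator {\<rho> / 2..\<rho>} t \<le> heat_kernel d \<rho> t * v t"
    proof (cases "t \<in> {\<rho> / 2..\<rho>}")
      case True
      have "(4 * pi * \<rho>) powr (- d / 2) \<le> (4 * pi * t) powr (- d / 2)"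
        using True assms by (intro powr_mono2') auto
      moreover have "exp (- 1 / 2) \<le> exp (- \<rho> / (4 * t))" using True assms by (simp add: field_simps)
      moreover have "v \<rho> \<le> v t" using True assms by (intro v_antimono) auto
      ultimately have "(4 * pi * \<rho>) powr (- d / 2) * exp (- 1 / 2) * v \<rho> \<le> heat_kernel d \<rho> t * v t"
        unfolding heat_kernel_def by (intro mult_mono mult_nonneg_nonneg v_nonneg) auto
      then show ?thesis using True by simp
    qed (simp add: heat_kernel_nonneg v_nonneg)
  qed
  also have "(\<integral>t. (4 * pi * \<rho>) powr (- d / 2) * exp (- 1 / 2) * v \<rho> * indicator {\<rho> / 2..\<rho>} t \<partial>lborel)
     = (4 * pi * \<rho>) powr (- d / 2) * exp (- 1 / 2) * v \<rho> * (\<rho> / 2)"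
    using assms by simp
  also have "\<dots> = (4 * pi) powr (- d / 2) * exp (- 1 / 2) / 2 * (\<rho> powr (1 - d / 2) * v \<rho>)"
  proof -
    have "\<rho> powr (1 - d / 2) = \<rho> powr (- d / 2) * \<rho> powr 1"
      unfolding powr_add[symmetric] by (rule arg_cong[where f = "(powr) \<rho>"]) simp
    then have "\<rho> powr (1 - d / 2) = \<rho> powr (- d / 2) * \<rho>" using assms by simp
    then show ?thesis unfolding powr_mult by simp
  qed
  finally show ?thesis .
qed

text \<open>The condition \<open>\<kappa> < 1 + d/2\<close> makes \<open>t powr (- d/2) * t powr (\<kappa> - 2)\<close> integrable at infinity, so that
  the times between \<open>\<rho>\<close> and \<open>t\<^sub>0\<close> contribute the same order as the times near \<open>\<rho>\<close>. It also shows that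
  \<open>\<rho> powr (- d/2 - 1) * moment (1/\<rho>)\<close> stays away from \<open>0\<close>, so that it dominates the constant coming
  from times above \<open>t\<^sub>0\<close>.\<close>

lemma heat_integral_upper:
  assumes d: "0 < d" and \<kappa>: "\<kappa> < 1 + d / 2" and C: "0 < C" and t\<^sub>0: "0 < t\<^sub>0"
    and dens: "\<And>\<rho> t. 0 < \<rho> \<Longrightarrow> \<rho> \<le> t \<Longrightarrow> t \<le> t\<^sub>0 \<Longrightarrow> t\<^sup>2 * v t \<le> C * (t / \<rho>) powr \<kappa> * moment (1 / \<rho>)"
    and tail: "integrable lborel (\<lambda>t. (1 + 4 * t) powr (- d / 2) * v t)"
  obtains K where "0 < K"
    "\<And>\<rho>. 0 < \<rho> \<Longrightarrow> \<rho> \<le> min 1 t\<^sub>0 \<Longrightarrow> integrable lborel (\<lambda>t. heat_kernel d \<rho> t * v t)"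
    "\<And>\<rho>. 0 < \<rho> \<Longrightarrow> \<rho> \<le> min 1 t\<^sub>0 \<Longrightarrow>
       (\<integral>t. heat_kernel d \<rho> t * v t \<partial>lborel) \<le> K * (\<rho> powr (- d / 2 - 1) * moment (1 / \<rho>))"
proof -
  define a where "a = (4 * pi) powr (- d / 2)"
  have a: "0 < a" by (simp add: a_def)
  obtain E where E: "E > 0" "\<And>y. y > 0 \<Longrightarrow> y powr (d / 2 + 2) * exp (- y / 4) \<le> E"
    using powr_times_exp_bounded[of "d / 2 + 2"] d by auto
  define T where "T = (\<integral>t. (1 + 4 * t) powr (- d / 2) * v t \<partial>lborel)"
  have T: "0 \<le> T" unfolding T_def by (intro integral_nonneg_AE AE_I2) (simp add: v_nonneg)
  define C1 where "C1 = a * E * (4 * exp 1)"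
  define C2 where "C2 = a * C"
  define C3 where "C3 = a * (4 + 1 / t\<^sub>0) powr (d / 2)"
  define q where "q = 1 + d / 2 - \<kappa>"
  have q: "q > 0" using \<kappa> by (simp add: q_def)
  (* A positive lower bound for \<rho> powr (- d/2 - 1) * moment (1/\<rho>), from dens at t = t\<^sub>0. *)
  define b where "b = t\<^sub>0 powr (2 - \<kappa>) * v t\<^sub>0 / C"
  have b: "b > 0" using t\<^sub>0 C v_pos[of t\<^sub>0] by (simp add: b_def)
  have "4 + 1 / t\<^sub>0 > 0" using t\<^sub>0 by (simp add: add_pos_pos)
  then have Cs: "C1 > 0" "C2 > 0" "C3 > 0" using a E C by (auto simp: C1_def C2_def C3_def)
  (* The three summands dominate the integrand on t \<le> \<rho>, on \<rho> < t \<le> t\<^sub>0 and on t > t\<^sub>0, respectively. *)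
  define F where "F \<rho> t = C1 * (\<rho> powr (- d / 2 - 2) * moment (1 / \<rho>)) * indicator {0..\<rho>} t
     + C2 * (\<rho> powr (- \<kappa>) * moment (1 / \<rho>)) * (t powr (- q - 1) * indicator {\<rho>..} t)
     + C3 * ((1 + 4 * t) powr (- d / 2) * v t)" for \<rho> t
  have F: "has_bochner_integral lborel (F \<rho>) (C1 * (\<rho> powr (- d / 2 - 2) * moment (1 / \<rho>)) * \<rho>
     + C2 * (\<rho> powr (- \<kappa>) * moment (1 / \<rho>)) * (\<rho> powr (- q - 1 + 1) / (- (- q - 1) - 1)) + C3 * T)"
    if "0 < \<rho>" for \<rho>
  proof -
    have "has_bochner_integral lborel (indicator {0..\<rho>} :: real \<Rightarrow> real) (measure lborel {0..\<rho>})"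
      using that by (intro has_bochner_integral_real_indicator) auto
    then have "has_bochner_integral lborel (indicator {0..\<rho>} :: real \<Rightarrow> real) \<rho>"
      using that by simp
    then show ?thesis unfolding F_def T_def using that q tail
      by (intro has_bochner_integral_add has_bochner_integral_mult_right has_bochner_integral_powr_tail
          has_bochner_integral_integrable) auto
  qed
  have bound: "heat_kernel d \<rho> t * v t \<le> F \<rho> t" if \<rho>: "0 < \<rho>" "\<rho> \<le> t\<^sub>0" for \<rho> t
  proof -
    define m where "m = moment (1 / \<rho>)"
    have m: "m > 0" using moment_pos[of "1 / \<rho>"] \<rho> by (simp add: m_def)
    have n1: "0 \<le> C1 * (\<rho> powr (- d / 2 - 2) * m) * indicator {0..\<rho>} t"
      and n2: "0 \<le> C2 * (\<rho> powr (- \<kappa>) * m) * (t powr (- q - 1) * indicator {\<rho>..} t)"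
      and n3: "0 \<le> C3 * ((1 + 4 * t) powr (- d / 2) * v t)"
      using Cs m v_nonneg by (auto intro!: mult_nonneg_nonneg)
    have hk: "heat_kernel d \<rho> t = a * (t powr (- d / 2) * exp (- \<rho> / (4 * t)))" if "t > 0"
      using that by (simp add: heat_kernel_def a_def powr_mult)
    have hk2: "heat_kernel d \<rho> t \<le> a * t powr (- d / 2)" if "t > 0"
    proof -
      have "exp (- \<rho> / (4 * t)) \<le> 1" using that \<rho> by simp
      from mult_left_mono[OF this, of "a * t powr (- d / 2)"] show ?thesis using a hk that by (simp add: mult_ac)
    qed
    consider "t \<le> 0" | "0 < t" "t \<le> \<rho>" | "\<rho> < t" "t \<le> t\<^sub>0" | "t\<^sub>0 < t" by linarith
    then have "heat_kernel d \<rho> t * v t \<le> C1 * (\<rho> powr (- d / 2 - 2) * m) * indicator {0..\<rho>} t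
     + C2 * (\<rho> powr (- \<kappa>) * m) * (t powr (- q - 1) * indicator {\<rho>..} t)
     + C3 * ((1 + 4 * t) powr (- d / 2) * v t)"
    proof cases
      case 1 then show ?thesis using n1 n2 n3 v_zero[of t] by simp
    next
      case 2
      have "t\<^sup>2 * v t \<le> 4 * exp 1 * moment (1 / t)" using 2 by (intro density_le_moment)
      also have "\<dots> \<le> 4 * exp 1 * m" unfolding m_def
        using 2 \<rho> by (intro mult_left_mono moment_antimono) (auto simp: field_simps)
      finally have v: "t\<^sup>2 * v t \<le> 4 * exp 1 * m" .
      have r1: "\<rho> powr (- d / 2 - 2) = inverse (\<rho> powr (d / 2 + 2))"
        using powr_minus[of \<rho> "d / 2 + 2"] by simp
      have r2: "t powr (d / 2 + 2) = t powr (d / 2) * t\<^sup>2"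
        using 2 by (simp add: powr_add)
      have r3: "t powr (- d / 2) = inverse (t powr (d / 2))"
        using powr_minus[of t "d / 2"] by simp
      have r4: "inverse R * (R / (A * t\<^sup>2)) = inverse A / t\<^sup>2" if "R > 0" for R A
        using that by (simp add: field_simps)
      have "\<rho> powr (- d / 2 - 2) * (\<rho> / t) powr (d / 2 + 2) = t powr (- d / 2) / t\<^sup>2"
        unfolding r1 r3 powr_divide r2 by (rule r4) (use \<rho> in simp)
      then have "t powr (- d / 2) * exp (- \<rho> / (4 * t)) / t\<^sup>2 =
          \<rho> powr (- d / 2 - 2) * ((\<rho> / t) powr (d / 2 + 2) * exp (- (\<rho> / t) / 4))"
        by (simp add: mult.assoc[symmetric])
      also have "\<dots> \<le> \<rho> powr (- d / 2 - 2) * E"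
        using E(2)[of "\<rho> / t"] 2 \<rho> by (intro mult_left_mono) auto
      finally have e: "t powr (- d / 2) * exp (- \<rho> / (4 * t)) / t\<^sup>2 \<le> \<rho> powr (- d / 2 - 2) * E" .
      have "heat_kernel d \<rho> t * v t = a * (t powr (- d / 2) * exp (- \<rho> / (4 * t)) / t\<^sup>2) * (t\<^sup>2 * v t)"
        using 2 hk by simp
      also have "\<dots> \<le> a * (\<rho> powr (- d / 2 - 2) * E) * (4 * exp 1 * m)"
        by (rule mult_mono[OF mult_left_mono[OF e] v]) (use a E v_nonneg[of t] in auto)
      also have "\<dots> = C1 * (\<rho> powr (- d / 2 - 2) * m) * indicator {0..\<rho>} t"
        using 2 by (simp add: C1_def)
      finally show ?thesis using n2 n3 by linarith
    next
      case 3
      have t: "t > 0" using 3 \<rho> by simp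
      have "heat_kernel d \<rho> t * v t \<le> a * t powr (- d / 2) * v t"
        using hk2 t v_nonneg by (intro mult_right_mono) auto
      also have "\<dots> = a * t powr (- d / 2 - 2) * (t\<^sup>2 * v t)"
        using t by (simp add: powr_diff)
      also have "\<dots> \<le> a * t powr (- d / 2 - 2) * (C * (t / \<rho>) powr \<kappa> * m)"
        unfolding m_def using 3 \<rho> a by (intro mult_left_mono dens) auto
      also have "\<dots> = C2 * (\<rho> powr (- \<kappa>) * m) * (t powr (- q - 1) * indicator {\<rho>..} t)"
      proof -
        have "t powr (- q - 1) = t powr (- d / 2 - 2) * t powr \<kappa>"
          unfolding powr_add[symmetric] by (rule arg_cong[where f = "(powr) t"]) (simp add: q_def)
        moreover have "(t / \<rho>) powr \<kappa> = t powr \<kappa> * \<rho> powr (- \<kappa>)"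
          unfolding powr_divide powr_minus by (rule divide_inverse)
        ultimately show ?thesis using 3 by (simp add: C2_def mult_ac)
      qed
      finally show ?thesis using n1 n3 by linarith
    next
      case 4
      have t: "t > 0" using 4 t\<^sub>0 by simp
      have w: "4 + 1 / t\<^sub>0 > 0" using t\<^sub>0 by (simp add: add_pos_pos)
      have "t powr (- d / 2) \<le> ((1 + 4 * t) / (4 + 1 / t\<^sub>0)) powr (- d / 2)"
      proof (rule powr_mono2')
        show "(1 + 4 * t) / (4 + 1 / t\<^sub>0) > 0" using t w by simp
        have "1 \<le> t / t\<^sub>0" using 4 t\<^sub>0 by simp
        then have "1 + 4 * t \<le> t * (4 + 1 / t\<^sub>0)" by (simp add: algebra_simps)
        then show "(1 + 4 * t) / (4 + 1 / t\<^sub>0) \<le> t"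
          using w by (simp only: pos_divide_le_eq)
      qed (use d in auto)
      also have "\<dots> = (4 + 1 / t\<^sub>0) powr (d / 2) * (1 + 4 * t) powr (- d / 2)"
        unfolding powr_divide using powr_minus_divide[of "4 + 1 / t\<^sub>0" "d / 2"] w by simp
      finally have "a * t powr (- d / 2) \<le> C3 * (1 + 4 * t) powr (- d / 2)"
        unfolding C3_def mult.assoc by (rule mult_left_mono) (use a in simp)
      with hk2[OF t] have "heat_kernel d \<rho> t \<le> C3 * (1 + 4 * t) powr (- d / 2)" by (rule order_trans)
      from mult_right_mono[OF this v_nonneg[of t]]
      have "heat_kernel d \<rho> t * v t \<le> C3 * ((1 + 4 * t) powr (- d / 2) * v t)"
        by (simp only: mult.assoc)
      then show ?thesis using n1 n2 by linarith
    qed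
    then show ?thesis by (simp add: F_def m_def)
  qed
  have int: "integrable lborel (\<lambda>t. heat_kernel d \<rho> t * v t)" if \<rho>: "0 < \<rho>" "\<rho> \<le> min 1 t\<^sub>0" for \<rho>
  proof (rule Bochner_Integration.integrable_bound[OF integrable.intros[OF F[OF \<rho>(1)]]])
    show "AE t in lborel. norm (heat_kernel d \<rho> t * v t) \<le> norm (F \<rho> t)"
    proof (rule AE_I2)
      fix t
      have "0 \<le> heat_kernel d \<rho> t * v t" by (simp add: heat_kernel_nonneg v_nonneg)
      then show "norm (heat_kernel d \<rho> t * v t) \<le> norm (F \<rho> t)"
        using bound[of \<rho> t] \<rho> by simp
    qed
  qed measurable
  have upper: "(\<integral>t. heat_kernel d \<rho> t * v t \<partial>lborel) \<le> (C1 + C2 / q + C3 * T / b) * (\<rho> powr (- d / 2 - 1) * moment (1 / \<rho>))"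
    if \<rho>: "0 < \<rho>" "\<rho> \<le> min 1 t\<^sub>0" for \<rho>
  proof -
    define m where "m = moment (1 / \<rho>)"
    have m: "m > 0" using moment_pos[of "1 / \<rho>"] \<rho> by (simp add: m_def)
    have e0: "(\<integral>t. heat_kernel d \<rho> t * v t \<partial>lborel) \<le> (\<integral>t. F \<rho> t \<partial>lborel)"
      using int[OF \<rho>] integrable.intros[OF F[OF \<rho>(1)]] bound \<rho> by (intro integral_mono) auto
    have e1: "(\<integral>t. F \<rho> t \<partial>lborel) = C1 * (\<rho> powr (- d / 2 - 2) * m) * \<rho>
       + C2 * (\<rho> powr (- \<kappa>) * m) * (\<rho> powr (- q - 1 + 1) / (- (- q - 1) - 1)) + C3 * T"
      unfolding m_def by (rule has_bochner_integral_integral_eq[OF F[OF \<rho>(1)]])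
    have e2: "C1 * (\<rho> powr (- d / 2 - 2) * m) * \<rho> = C1 * (\<rho> powr (- d / 2 - 1) * m)"
    proof -
      have "\<rho> powr (- d / 2 - 1) = \<rho> powr (- d / 2 - 2) * \<rho> powr 1"
        unfolding powr_add[symmetric] by (rule arg_cong[where f = "(powr) \<rho>"]) simp
      then have "\<rho> powr (- d / 2 - 1) = \<rho> powr (- d / 2 - 2) * \<rho>" using \<rho> by simp
      then show ?thesis by (simp only: mult_ac)
    qed
    have e3: "C2 * (\<rho> powr (- \<kappa>) * m) * (\<rho> powr (- q - 1 + 1) / (- (- q - 1) - 1)) = C2 / q * (\<rho> powr (- d / 2 - 1) * m)"
    proof -
      have "\<rho> powr (- \<kappa>) * \<rho> powr (- q) = \<rho> powr (- d / 2 - 1)"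
        unfolding powr_add[symmetric] by (rule arg_cong[where f = "(powr) \<rho>"]) (simp add: q_def)
      from this[symmetric] have "\<rho> powr (- d / 2 - 1) = \<rho> powr (- \<kappa>) * \<rho> powr (- q - 1 + 1)" by simp
      moreover have "- (- q - 1) - 1 = q" by simp
      ultimately show ?thesis by (simp only: mult_ac times_divide_eq_left times_divide_eq_right)
    qed
    have e4: "C3 * T \<le> C3 * T / b * (\<rho> powr (- d / 2 - 1) * m)"
    proof -
      have "t\<^sub>0\<^sup>2 * v t\<^sub>0 \<le> C * (t\<^sub>0 / \<rho>) powr \<kappa> * m" unfolding m_def using \<rho> by (intro dens) auto
      moreover have "(t\<^sub>0 / \<rho>) powr \<kappa> = t\<^sub>0 powr \<kappa> * \<rho> powr (- \<kappa>)"
        unfolding powr_divide powr_minus by (rule divide_inverse)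
      ultimately have "t\<^sub>0\<^sup>2 * v t\<^sub>0 \<le> (\<rho> powr (- \<kappa>) * m) * (C * t\<^sub>0 powr \<kappa>)"
        by (simp only: mult_ac)
      moreover have "b = t\<^sub>0\<^sup>2 * v t\<^sub>0 / (C * t\<^sub>0 powr \<kappa>)"
        using t\<^sub>0 by (simp add: b_def powr_diff)
      ultimately have "b \<le> \<rho> powr (- \<kappa>) * m"
        using t\<^sub>0 C by (simp only: pos_divide_le_eq mult_pos_pos powr_gt_zero)
      also have "\<dots> \<le> \<rho> powr (- d / 2 - 1) * m"
        using \<rho> m \<kappa> by (intro mult_right_mono powr_mono') auto
      finally have "1 \<le> \<rho> powr (- d / 2 - 1) * m / b" using b by simp
      from mult_left_mono[OF this, of "C3 * T"] show ?thesis using Cs T by simp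
    qed
    show ?thesis using e0[unfolded e1 e2 e3] e4 unfolding distrib_right m_def[symmetric] by linarith
  qed
  have "0 \<le> C3 * T / b" "0 < C2 / q" using Cs q T b by (auto intro!: divide_nonneg_pos mult_nonneg_nonneg)
  then have "0 < C1 + C2 / q + C3 * T / b" using Cs by linarith
  then show thesis
    by (rule that[of "C1 + C2 / q + C3 * T / b"]) (fact int upper)+
qed

text \<open>Passing from \<open>\<phi>'\<close> to \<open>moment = \<phi>' / \<phi>\<^sup>2\<close> preserves upper scaling because \<open>\<phi> = 1 / laplace\<close> is increasing.\<close>

lemma moment_scaling_upper:
  assumes "0 < l\<^sub>0" "0 \<le> \<sigma>"
    and A3: "\<And>x l. 1 \<le> x \<Longrightarrow> l\<^sub>0 \<le> l \<Longrightarrow> moment (l * x) / (laplace (l * x))\<^sup>2 \<le> \<sigma> * x powr (- \<delta>) * (moment l / (laplace l)\<^sup>2)"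
    and "1 \<le> x" "l\<^sub>0 \<le> l"
  shows "moment (l * x) \<le> \<sigma> * x powr (- \<delta>) * moment l"
proof -
  have l: "0 < l" "0 < l * x" "l \<le> l * x" using assms by auto
  have "moment (l * x) = (moment (l * x) / (laplace (l * x))\<^sup>2) * (laplace (l * x))\<^sup>2"
    using laplace_pos[OF l(2)] by simp
  also have "\<dots> \<le> (\<sigma> * x powr (- \<delta>) * (moment l / (laplace l)\<^sup>2)) * (laplace l)\<^sup>2"
    using A3[OF assms(4,5)] laplace_antimono[OF l(1,3)] laplace_pos[OF l(2)] laplace_pos[OF l(1)] moment_pos[OF l(1)] assms(2)
    by (intro mult_mono power_mono mult_nonneg_nonneg divide_nonneg_nonneg) auto
  also have "\<dots> = \<sigma> * x powr (- \<delta>) * moment l" using laplace_pos[OF l(1)] by simp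
  finally show ?thesis .
qed

text \<open>The hypotheses A3 and B are those on \<open>\<phi>'\<close>, written out for \<open>\<phi> = 1 / laplace\<close>.\<close>

lemma heat_integral_comparable:
  fixes d :: nat
  assumes d: "1 \<le> d" and pos: "0 < \<sigma>" "0 < l\<^sub>0" "0 < \<delta>"
    and A3: "\<And>x l. 1 \<le> x \<Longrightarrow> l\<^sub>0 \<le> l \<Longrightarrow> moment (l * x) / (laplace (l * x))\<^sup>2 \<le> \<sigma> * x powr (- \<delta>) * (moment l / (laplace l)\<^sup>2)"
    and B: "d \<le> 2 \<Longrightarrow> \<exists>\<sigma>'>0. \<exists>\<delta>'. \<delta>' < 1 + d / 2 \<and> \<delta>' < 2 * \<delta> + (real d - 2) / 2 \<and>
       (\<forall>x\<ge>1. \<forall>l\<ge>l\<^sub>0. \<sigma>' * x powr (- \<delta>') * (moment l / (laplace l)\<^sup>2) \<le> moment (l * x) / (laplace (l * x))\<^sup>2)"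
    and tail: "integrable lborel (\<lambda>t. (1 + 4 * t) powr (- real d / 2) * v t)"
  obtains c K \<rho>\<^sub>0 where "0 < c" "0 < K" "0 < \<rho>\<^sub>0"
    "\<And>\<rho>. 0 < \<rho> \<Longrightarrow> \<rho> \<le> \<rho>\<^sub>0 \<Longrightarrow> c * (\<rho> powr (- real d / 2 - 1) * moment (1 / \<rho>)) \<le> (\<integral>t. heat_kernel d \<rho> t * v t \<partial>lborel)"
    "\<And>\<rho>. 0 < \<rho> \<Longrightarrow> \<rho> \<le> \<rho>\<^sub>0 \<Longrightarrow> (\<integral>t. heat_kernel d \<rho> t * v t \<partial>lborel) \<le> K * (\<rho> powr (- real d / 2 - 1) * moment (1 / \<rho>))"
proof -
  have d0: "0 < real d" using d by simp
  have "\<exists>\<kappa> C. \<kappa> < 1 + real d / 2 \<and> 0 < C \<and>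
     (\<forall>\<rho> t. 0 < \<rho> \<longrightarrow> \<rho> \<le> t \<longrightarrow> t \<le> 1 / l\<^sub>0 \<longrightarrow> t\<^sup>2 * v t \<le> C * (t / \<rho>) powr \<kappa> * moment (1 / \<rho>))"
  proof (cases "d \<le> 2")
    case True
    then obtain \<sigma>' \<delta>' where \<sigma>': "0 < \<sigma>'" and \<delta>': "\<delta>' < 1 + d / 2" "\<delta>' < 2 * \<delta> + (real d - 2) / 2"
      and B': "\<And>x l. 1 \<le> x \<Longrightarrow> l\<^sub>0 \<le> l \<Longrightarrow> \<sigma>' * x powr (- \<delta>') * (moment l / (laplace l)\<^sup>2) \<le> moment (l * x) / (laplace (l * x))\<^sup>2"
      using B by blast
    (* The growth estimate needs an exponent below 1. If \<delta> \<ge> 1, it is lowered to a value below 1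
       for which \<delta>' + 2 (1 - \<delta>\<^sub>1) is still less than 1 + d/2. *)
    define \<delta>\<^sub>1 where "\<delta>\<^sub>1 = (if \<delta> < 1 then \<delta> else (1 + (\<delta>' + 1 - d / 2) / 2) / 2)"
    have \<delta>\<^sub>1: "\<delta>\<^sub>1 < 1" "\<delta>\<^sub>1 \<le> \<delta>" "\<delta>' < 2 * \<delta>\<^sub>1 + d / 2 - 1"
      using \<delta>' by (auto simp: \<delta>\<^sub>1_def field_simps)
    have A3': "moment (l * x) / (laplace (l * x))\<^sup>2 \<le> \<sigma> * x powr (- \<delta>\<^sub>1) * (moment l / (laplace l)\<^sup>2)" if "1 \<le> x" "l\<^sub>0 \<le> l" for x l
    proof -
      have "0 < l" using that pos by simp
      have "\<sigma> * x powr (- \<delta>) * (moment l / (laplace l)\<^sup>2) \<le> \<sigma> * x powr (- \<delta>\<^sub>1) * (moment l / (laplace l)\<^sup>2)"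
        using that pos \<delta>\<^sub>1 moment_pos[OF \<open>0 < l\<close>] by (intro mult_right_mono mult_left_mono powr_mono) auto
      then show ?thesis using A3[OF that] by linarith
    qed
    define C where "C = 4 * exp 1 * ((max 1 (\<sigma> / (1 - \<delta>\<^sub>1)))\<^sup>2 / \<sigma>')"
    have "t\<^sup>2 * v t \<le> C * (t / \<rho>) powr (\<delta>' + 2 * (1 - \<delta>\<^sub>1)) * moment (1 / \<rho>)" if t: "0 < \<rho>" "\<rho> \<le> t" "t \<le> 1 / l\<^sub>0" for t \<rho>
    proof -
      have "t\<^sup>2 * v t \<le> 4 * exp 1 * moment (1 / t)" using t by (intro density_le_moment) auto
      also have "\<dots> \<le> 4 * exp 1 * (((max 1 (\<sigma> / (1 - \<delta>\<^sub>1)))\<^sup>2 / \<sigma>') * (t / \<rho>) powr (\<delta>' + 2 * (1 - \<delta>\<^sub>1)) * moment (1 / t * (t / \<rho>)))"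
        using t pos
        by (intro mult_left_mono moment_scaling_lower[OF \<delta>\<^sub>1(1) pos(2,1) \<sigma>' A3' B']) (auto simp: field_simps)
      also have "1 / t * (t / \<rho>) = 1 / \<rho>" using t by simp
      finally show ?thesis unfolding C_def by (simp only: mult.assoc)
    qed
    moreover have "\<delta>' + 2 * (1 - \<delta>\<^sub>1) < 1 + real d / 2" using \<delta>\<^sub>1 by simp
    moreover have "max 1 (\<sigma> / (1 - \<delta>\<^sub>1)) > 0" by simp
    then have "0 < C" using \<sigma>' by (simp add: C_def)
    ultimately show ?thesis by blast
  next
    case False
    (* For d \<ge> 3 the exponent \<kappa> = 2 suffices: v t \<le> v \<rho>. *)
    have "t\<^sup>2 * v t \<le> 4 * exp 1 * (t / \<rho>) powr 2 * moment (1 / \<rho>)" if t: "0 < \<rho>" "\<rho> \<le> t" for t \<rho>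
    proof -
      have "t\<^sup>2 * v t \<le> t\<^sup>2 * v \<rho>" using t by (intro mult_left_mono v_antimono) auto
      also have "\<dots> = (t / \<rho>)\<^sup>2 * (\<rho>\<^sup>2 * v \<rho>)" using t by (simp add: power_divide)
      also have "\<dots> \<le> (t / \<rho>)\<^sup>2 * (4 * exp 1 * moment (1 / \<rho>))" using t by (intro mult_left_mono density_le_moment) auto
      finally show ?thesis using t by (simp add: mult_ac)
    qed
    moreover have "2 < 1 + real d / 2" using False by simp
    ultimately show ?thesis by (intro exI[of _ 2] exI[of _ "4 * exp 1"]) auto
  qed
  then obtain \<kappa> C where \<kappa>: "\<kappa> < 1 + real d / 2" and C: "0 < C"
    and dens: "\<And>\<rho> t. 0 < \<rho> \<Longrightarrow> \<rho> \<le> t \<Longrightarrow> t \<le> 1 / l\<^sub>0 \<Longrightarrow> t\<^sup>2 * v t \<le> C * (t / \<rho>) powr \<kappa> * moment (1 / \<rho>)"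
    by blast
  have t0: "0 < 1 / l\<^sub>0" using pos by simp
  obtain K where K: "0 < K"
    and int: "\<And>\<rho>. 0 < \<rho> \<Longrightarrow> \<rho> \<le> min 1 (1 / l\<^sub>0) \<Longrightarrow> integrable lborel (\<lambda>t. heat_kernel d \<rho> t * v t)"
    and up: "\<And>\<rho>. 0 < \<rho> \<Longrightarrow> \<rho> \<le> min 1 (1 / l\<^sub>0) \<Longrightarrow>
       (\<integral>t. heat_kernel d \<rho> t * v t \<partial>lborel) \<le> K * (\<rho> powr (- real d / 2 - 1) * moment (1 / \<rho>))"
    by (rule heat_integral_upper[OF d0 \<kappa> C t0 dens tail]) blast+
  obtain c\<^sub>1 t\<^sub>1 where c1: "0 < c\<^sub>1" "0 < t\<^sub>1" and low: "\<And>s. 0 < s \<Longrightarrow> s \<le> t\<^sub>1 \<Longrightarrow> c\<^sub>1 * moment (1 / s) \<le> s\<^sup>2 * v s"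
    by (rule moment_le_density_scaling[OF pos(1,3,2) moment_scaling_upper[OF pos(2) less_imp_le[OF pos(1)] A3]]) blast+
  define c where "c = (4 * pi) powr (- real d / 2) * exp (- 1 / 2) / 2"
  have c: "0 < c" by (simp add: c_def)
  show thesis
  proof (rule that[of "c * c\<^sub>1" K "min t\<^sub>1 (min 1 (1 / l\<^sub>0))"])
    fix \<rho> :: real assume \<rho>: "0 < \<rho>" "\<rho> \<le> min t\<^sub>1 (min 1 (1 / l\<^sub>0))"
    show "(\<integral>t. heat_kernel d \<rho> t * v t \<partial>lborel) \<le> K * (\<rho> powr (- real d / 2 - 1) * moment (1 / \<rho>))"
      using \<rho> by (intro up) auto
    have "\<rho> powr (1 - real d / 2) = \<rho> powr (- real d / 2 - 1) * \<rho> powr 2"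
      unfolding powr_add[symmetric] by (rule arg_cong[where f = "(powr) \<rho>"]) simp
    then have e: "\<rho> powr (1 - real d / 2) = \<rho> powr (- real d / 2 - 1) * \<rho>\<^sup>2" using \<rho> by simp
    have "c\<^sub>1 * moment (1 / \<rho>) \<le> \<rho>\<^sup>2 * v \<rho>" using \<rho> by (intro low) auto
    then have "c * (\<rho> powr (- real d / 2 - 1) * (c\<^sub>1 * moment (1 / \<rho>))) \<le> c * (\<rho> powr (- real d / 2 - 1) * (\<rho>\<^sup>2 * v \<rho>))"
      using c by (intro mult_left_mono) auto
    also have "\<dots> = c * (\<rho> powr (1 - real d / 2) * v \<rho>)" unfolding e by (simp only: mult.assoc)
    also have "\<dots> \<le> (\<integral>t. heat_kernel d \<rho> t * v t \<partial>lborel)"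
      unfolding c_def using \<rho> d0 by (intro heat_integral_lower int) auto
    finally show "c * c\<^sub>1 * (\<rho> powr (- real d / 2 - 1) * moment (1 / \<rho>)) \<le> (\<integral>t. heat_kernel d \<rho> t * v t \<partial>lborel)"
      by (simp only: mult_ac)
  qed (use c c1 K t0 in auto)
qed

end

section \<open>Subordinators and their potential measures\<close>

lemma levy_processD:
  assumes "levy_process P x X"
  shows "prob_space P" "0 \<le> t \<Longrightarrow> X t \<in> borel_measurable P" "AE \<omega> in P. X 0 \<omega> = x"
    "independent_increments P X" "stationary_increments P X"
  using assms by (auto simp: levy_process_def)

lemma levy_process_distr_increment:
  assumes X: "levy_process P 0 X" and "0 \<le> s" "s \<le> t"
  shows "distr P borel (\<lambda>\<omega>. X t \<omega> - X s \<omega>) = distr P borel (X (t - s))"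
proof -
  have [measurable]: "X (t - s) \<in> borel_measurable P" "X 0 \<in> borel_measurable P"
    using levy_processD(2)[OF X] assms by auto
  have "stationary_increments P X" using levy_processD(5)[OF X] .
  from this[unfolded stationary_increments_def, rule_format, of s "t - s"] assms
  have "distr P borel (\<lambda>\<omega>. X t \<omega> - X s \<omega>) = distr P borel (\<lambda>\<omega>. X (t - s) \<omega> - X 0 \<omega>)" by simp
  also have "\<dots> = distr P borel (X (t - s))"
  proof (rule distr_cong_AE)
    show "AE \<omega> in P. X (t - s) \<omega> - X 0 \<omega> = X (t - s) \<omega>"
      using levy_processD(3)[OF X] by eventually_elim simp
  qed auto
  finally show ?thesis .
qed

locale subordinator_process =
  fixes P :: "'w measure" and S :: "real \<Rightarrow> 'w \<Rightarrow> real" and \<phi> :: "real \<Rightarrow> real"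
  assumes sub: "subordinator P S" and lap: "laplace_exponent P S \<phi>"
begin

sublocale prob_space P
  using sub by (simp add: subordinator_def levy_process_def)

lemma S_levy: "levy_process P 0 S"
  using sub by (simp add: subordinator_def)

lemma S_measurable [measurable]: "0 \<le> t \<Longrightarrow> S t \<in> borel_measurable P"
  using sub by (simp add: subordinator_def levy_process_def)

lemma S_nonneg: "0 \<le> t \<Longrightarrow> \<omega> \<in> space P \<Longrightarrow> 0 \<le> S t \<omega>"
  using sub by (simp add: subordinator_def)

lemma S_0: "AE \<omega> in P. S 0 \<omega> = 0"
  using sub by (simp add: subordinator_def levy_process_def)

lemma S_mono:
  assumes "0 \<le> s" "s \<le> t"
  shows "AE \<omega> in P. S s \<omega> \<le> S t \<omega>"
proof -
  have [measurable]: "S s \<in> borel_measurable P" "S t \<in> borel_measurable P" "S (t - s) \<in> borel_measurable P"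
    using assms by auto
  have "AE \<omega> in P. 0 \<le> S (t - s) \<omega>" using S_nonneg[of "t - s"] assms by (intro AE_I2) auto
  then have "AE x in distr P borel (S (t - s)). 0 \<le> x" by (subst AE_distr_iff) auto
  then have "AE x in distr P borel (\<lambda>\<omega>. S t \<omega> - S s \<omega>). 0 \<le> x" unfolding levy_process_distr_increment[OF S_levy assms] .
  then have "AE \<omega> in P. 0 \<le> S t \<omega> - S s \<omega>" by (subst (asm) AE_distr_iff) auto
  then show ?thesis by simp
qed

text \<open>Negative times are mapped to \<open>0\<close>, so that \<open>marginal\<close> is a kernel on the whole line.\<close>

definition marginal :: "real \<Rightarrow> real measure" where
  "marginal t = distr P borel (S (max 0 t))"

lemma prob_space_marginal: "prob_space (marginal t)"
  unfolding marginal_def by (rule prob_space_distr) simp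

text \<open>The paths increase almost surely, so the probability of \<open>S t \<le> x\<close> decreases in \<open>t\<close> and is therefore
  measurable in \<open>t\<close>; the half-lines generate the Borel sets.\<close>

lemma marginal_measurable: "marginal \<in> borel \<rightarrow>\<^sub>M subprob_algebra borel"
proof (rule measurable_subprob_algebra_generated[where G = "range atMost" and \<Omega> = UNIV])
  show "sets borel = sigma_sets UNIV (range atMost :: real set set)"
    by (subst borel_eq_atMost) (simp add: sets_measure_of)
  show "Int_stable (range atMost :: real set set)" by (auto simp: Int_stable_def)
  fix t :: real
  interpret marginal: prob_space "marginal t" by (rule prob_space_marginal)
  show "subprob_space (marginal t)" by (rule marginal.subprob_space_axioms)
  show "sets (marginal t) = sets borel" by (simp add: marginal_def)
next
  fix A :: "real set" assume "A \<in> range atMost"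
  then obtain x where A: "A = {..x}" by auto
  have "antimono (\<lambda>t. measure (marginal t) {..x})"
  proof (rule antimonoI)
    fix s t :: real assume "s \<le> t"
    have "AE \<omega> in P. S (max 0 s) \<omega> \<le> S (max 0 t) \<omega>" using \<open>s \<le> t\<close> by (intro S_mono) auto
    then have "measure P {\<omega> \<in> space P. S (max 0 t) \<omega> \<le> x} \<le> measure P {\<omega> \<in> space P. S (max 0 s) \<omega> \<le> x}"
      by (intro finite_measure_mono_AE) auto
    moreover have "measure (marginal r) {..x} = measure P {\<omega> \<in> space P. S (max 0 r) \<omega> \<le> x}" for r
      unfolding marginal_def by (subst measure_distr) (auto intro!: arg_cong[where f = "measure P"])
    ultimately show "measure (marginal t) {..x} \<le> measure (marginal s) {..x}" by simp
  qed
  then have "mono (\<lambda>t. - measure (marginal t) {..x})" by (auto simp: mono_def antimono_def)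
  then have "(\<lambda>t. - measure (marginal t) {..x}) \<in> borel_measurable borel" by (rule borel_measurable_mono)
  then have "(\<lambda>t. - (- measure (marginal t) {..x})) \<in> borel_measurable borel" by (rule borel_measurable_uminus)
  then have m: "(\<lambda>t. ennreal (measure (marginal t) {..x})) \<in> borel_measurable borel" by simp
  have "emeasure (marginal t) {..x} = ennreal (measure (marginal t) {..x})" for t
  proof -
    interpret marginal: prob_space "marginal t" by (rule prob_space_marginal)
    show ?thesis by (rule marginal.emeasure_eq_measure)
  qed
  with m show "(\<lambda>t. emeasure (marginal t) A) \<in> borel_measurable borel" by (simp add: A)
next
  have "emeasure (marginal t) UNIV = 1" for t
  proof -
    interpret marginal: prob_space "marginal t" by (rule prob_space_marginal)
    show ?thesis using marginal.emeasure_space_1 by (simp add: marginal_def)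
  qed
  then show "(\<lambda>a. emeasure (marginal a) UNIV) \<in> borel_measurable borel" by simp
qed auto

lemma marginal_measurable_restrict: "marginal \<in> restrict_space lborel {0..} \<rightarrow>\<^sub>M subprob_algebra borel"
  using marginal_measurable by (intro measurable_restrict_space1) simp

text \<open>This identifies the potential measure with a genuine mixture of the marginal laws, so that its defining
  set function is countably additive.\<close>

lemma potential_measure_eq_bind:
  "potential_measure P S = restrict_space lborel {0..} \<bind> marginal"
proof -
  define N where "N = restrict_space lborel {0..} \<bind> marginal"
  have ne: "space (restrict_space lborel {0::real..}) \<noteq> {}" by (simp add: space_restrict_space)
  have sets: "sets N = sets borel" unfolding N_def
    by (rule sets_bind[OF _ ne]) (simp add: marginal_def)
  have eq: "emeasure N A = (\<integral>\<^sup>+t\<in>{0..}. emeasure P {\<omega> \<in> space P. S t \<omega> \<in> A} \<partial>lborel)" if A: "A \<in> sets borel" for A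
  proof -
    have "emeasure N A = (\<integral>\<^sup>+t. emeasure (marginal t) A \<partial>restrict_space lborel {0..})"
      unfolding N_def using ne marginal_measurable_restrict A by (rule emeasure_bind)
    also have "\<dots> = (\<integral>\<^sup>+t\<in>{0..}. emeasure (marginal t) A \<partial>lborel)"
      by (subst nn_integral_restrict_space) auto
    also have "\<dots> = (\<integral>\<^sup>+t\<in>{0..}. emeasure P {\<omega> \<in> space P. S t \<omega> \<in> A} \<partial>lborel)"
      using A by (intro nn_integral_cong)
        (auto simp: marginal_def emeasure_distr max_def split: split_indicator intro!: arg_cong[where f = "emeasure P"])
    finally show ?thesis .
  qed
  have "potential_measure P S = measure_of (space N) (sets N) (emeasure N)"
    unfolding potential_measure_def
    unfolding sets sets_eq_imp_space_eq[OF sets] space_borel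
    using eq sets.sigma_sets_eq[of "borel :: real measure"] by (intro measure_of_eq) auto
  also have "\<dots> = N" by (rule measure_of_of_measure)
  finally show ?thesis by (simp add: N_def)
qed

lemma nn_integral_potential_measure:
  assumes "f \<in> borel_measurable borel"
  shows "(\<integral>\<^sup>+x. f x \<partial>potential_measure P S) = (\<integral>\<^sup>+t\<in>{0..}. (\<integral>\<^sup>+\<omega>. f (S t \<omega>) \<partial>P) \<partial>lborel)"
proof -
  have "(\<integral>\<^sup>+x. f x \<partial>potential_measure P S) = (\<integral>\<^sup>+t. (\<integral>\<^sup>+x. f x \<partial>marginal t) \<partial>restrict_space lborel {0..})"
    unfolding potential_measure_eq_bind using assms marginal_measurable_restrict by (rule nn_integral_bind)
  also have "\<dots> = (\<integral>\<^sup>+t\<in>{0..}. (\<integral>\<^sup>+x. f x \<partial>marginal t) \<partial>lborel)"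
    by (subst nn_integral_restrict_space) auto
  also have "\<dots> = (\<integral>\<^sup>+t\<in>{0..}. (\<integral>\<^sup>+\<omega>. f (S t \<omega>) \<partial>P) \<partial>lborel)"
    using assms by (intro nn_integral_cong) (auto simp: marginal_def nn_integral_distr max_def split: split_indicator)
  finally show ?thesis .
qed

lemma expectation_exp: "0 \<le> t \<Longrightarrow> 0 < l \<Longrightarrow> expectation (\<lambda>\<omega>. exp (- (l * S t \<omega>))) = exp (- t * \<phi> l)"
  using lap by (simp add: laplace_exponent_def)

lemma exp_integrable: "0 \<le> t \<Longrightarrow> 0 < l \<Longrightarrow> integrable P (\<lambda>\<omega>. exp (- (l * S t \<omega>)))"
  using S_nonneg[of t] by (intro integrable_const_bound[of _ 1] AE_I2) auto

text \<open>Otherwise \<open>S t = 0\<close> almost surely for every \<open>t\<close>, and the potential measure charges the origin.\<close>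

lemma phi_pos:
  assumes A1: "emeasure (potential_measure P S) {0} = 0" and l: "0 < l"
  shows "0 < \<phi> l"
proof (rule ccontr)
  assume "\<not> 0 < \<phi> l"
  have "emeasure P {\<omega> \<in> space P. S t \<omega> \<in> {0}} = 1" if t: "0 \<le> t" for t
  proof -
    have [measurable]: "S t \<in> borel_measurable P" using t by simp
    have i: "integrable P (\<lambda>\<omega>. 1 - exp (- (l * S t \<omega>)))" using exp_integrable[OF t l] by simp
    have nn: "AE \<omega> in P. 0 \<le> 1 - exp (- (l * S t \<omega>))" using S_nonneg[OF t] l by (intro AE_I2) auto
    have "expectation (\<lambda>\<omega>. 1 - exp (- (l * S t \<omega>))) = 1 - exp (- t * \<phi> l)"
      using expectation_exp[OF t l] exp_integrable[OF t l] by (simp add: prob_space)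
    also have "\<dots> \<le> 0" using \<open>\<not> 0 < \<phi> l\<close> t by (simp add: mult_nonneg_nonpos)
    finally have "expectation (\<lambda>\<omega>. 1 - exp (- (l * S t \<omega>))) = 0"
      using integral_nonneg_AE[OF nn] by linarith
    then have "AE \<omega> in P. 1 - exp (- (l * S t \<omega>)) = 0"
      using integral_nonneg_eq_0_iff_AE[OF i nn] by simp
    then have "AE \<omega> in P. S t \<omega> \<in> {0}" by eventually_elim (use l in simp)
    then show ?thesis by (intro emeasure_eq_1_AE) auto
  qed
  note S_eq_0 = this
  have "emeasure (potential_measure P S) {0} = (\<integral>\<^sup>+x. indicator {0} x \<partial>potential_measure P S)"
    by (subst nn_integral_indicator) (auto simp: potential_measure_def)
  also have "\<dots> = (\<integral>\<^sup>+t\<in>{0..}. (\<integral>\<^sup>+\<omega>. indicator {0} (S t \<omega>) \<partial>P) \<partial>lborel)"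
    by (rule nn_integral_potential_measure) simp
  also have "\<dots> = (\<integral>\<^sup>+t. indicator {0..} t \<partial>(lborel :: real measure))"
  proof (rule nn_integral_cong)
    fix t :: real
    show "(\<integral>\<^sup>+\<omega>. indicator {0} (S t \<omega>) \<partial>P) * indicator {0..} t = (indicator {0..} t :: ennreal)"
    proof (cases "0 \<le> t")
      case True
      have "(\<integral>\<^sup>+\<omega>. indicator {0} (S t \<omega>) \<partial>P) = (\<integral>\<^sup>+\<omega>. indicator {\<omega> \<in> space P. S t \<omega> \<in> {0}} \<omega> \<partial>P)"
        by (intro nn_integral_cong) (auto split: split_indicator)
      also have "\<dots> = emeasure P {\<omega> \<in> space P. S t \<omega> \<in> {0}}"
        using measurable_sets[OF S_measurable[OF True], of "{0}"]
        by (intro nn_integral_indicator) (simp add: vimage_def Int_def conj_commute)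
      finally show ?thesis using S_eq_0[OF True] by simp
    qed simp
  qed
  also have "\<dots> = emeasure lborel {0::real..}" by simp
  finally have "emeasure lborel {0::real..} = 0" using A1 by simp
  moreover have "emeasure lborel {0..1::real} \<le> emeasure lborel {0::real..}" by (intro emeasure_mono) auto
  ultimately show False by simp
qed

lemma laplace_transform_potential_measure:
  assumes "0 < l" "0 < \<phi> l"
  shows "(\<integral>\<^sup>+x. ennreal (exp (- (l * x))) \<partial>potential_measure P S) = ennreal (1 / \<phi> l)"
proof -
  have "(\<integral>\<^sup>+x. ennreal (exp (- (l * x))) \<partial>potential_measure P S) =
      (\<integral>\<^sup>+t\<in>{0..}. (\<integral>\<^sup>+\<omega>. ennreal (exp (- (l * S t \<omega>))) \<partial>P) \<partial>lborel)"
    by (rule nn_integral_potential_measure) simp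
  also have "\<dots> = (\<integral>\<^sup>+t\<in>{0..}. ennreal (exp (- (\<phi> l * t))) \<partial>lborel)"
  proof (rule nn_integral_cong)
    fix t :: real
    show "(\<integral>\<^sup>+\<omega>. ennreal (exp (- (l * S t \<omega>))) \<partial>P) * indicator {0..} t = ennreal (exp (- (\<phi> l * t))) * indicator {0..} t"
      using exp_integrable[of t l] expectation_exp[of t l] assms
      by (cases "0 \<le> t") (auto simp: nn_integral_eq_integral mult.commute)
  qed
  also have "\<dots> = ennreal (0 - (- exp (- (\<phi> l * 0)) / \<phi> l))"
  proof (rule nn_integral_FTC_atLeast)
    show "((\<lambda>t. - exp (- (\<phi> l * t)) / \<phi> l) has_real_derivative exp (- (\<phi> l * t))) (at t)" for t
      using assms by (auto intro!: derivative_eq_intros)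
    have "((\<lambda>t. exp (- (\<phi> l * t))) \<longlongrightarrow> 0) at_top"
      using assms by (intro filterlim_compose[OF exp_at_bot] filterlim_compose[OF filterlim_uminus_at_bot_at_top]
        filterlim_tendsto_pos_mult_at_top[OF tendsto_const]) (auto intro: filterlim_ident)
    from tendsto_divide[OF tendsto_minus[OF this] tendsto_const[of "\<phi> l"]] 
    show "((\<lambda>t. - exp (- (\<phi> l * t)) / \<phi> l) \<longlongrightarrow> 0) at_top" using assms by simp
  qed auto
  finally show ?thesis by simp
qed

end

section \<open>Gaussian functions of Brownian motion\<close>

lemma char_product_normal:
  fixes c :: "'i \<Rightarrow> real"
  assumes "finite I"
  shows "(CLINT w|PiM I (\<lambda>_. std_normal_distribution). iexp (\<Sum>b\<in>I. c b * w b))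
    = complex_of_real (exp (- (\<Sum>b\<in>I. (c b)\<^sup>2) / 2))"
proof -
  interpret N: real_distribution std_normal_distribution by (rule real_dist_normal_dist)
  interpret product_sigma_finite "\<lambda>_::'i. std_normal_distribution" ..
  have "(CLINT w|PiM I (\<lambda>_. std_normal_distribution). iexp (\<Sum>b\<in>I. c b * w b))
      = (CLINT w|PiM I (\<lambda>_. std_normal_distribution). (\<Prod>b\<in>I. iexp (c b * w b)))"
    using assms by (simp add: sum_distrib_left exp_sum)
  also have "\<dots> = (\<Prod>b\<in>I. CLINT x|std_normal_distribution. iexp (c b * x))"
    using assms by (intro product_integral_prod N.integrable_iexp) auto
  also have "\<dots> = (\<Prod>b\<in>I. complex_of_real (exp (- (c b)\<^sup>2 / 2)))"
    using fun_cong[OF char_std_normal_distribution] by (simp add: char_def)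
  also have "\<dots> = complex_of_real (exp (- (\<Sum>b\<in>I. (c b)\<^sup>2) / 2))"
    using assms by (simp add: sum_negf[symmetric] sum_divide_distrib exp_sum del: of_real_exp flip: of_real_prod)
  finally show ?thesis .
qed

lemma integral_exp_square_normal:
  assumes "0 \<le> s"
  shows "(LINT x|std_normal_distribution. exp (- (s * x\<^sup>2))) = (1 + 2 * s) powr (- 1 / 2)"
proof -
  define \<tau> where "\<tau> = 1 / sqrt (1 + 2 * s)"
  have s: "1 + 2 * s > 0" using assms by simp
  then have \<tau>: "\<tau> > 0" "\<tau>\<^sup>2 = 1 / (1 + 2 * s)" by (auto simp: \<tau>_def power_divide)
  have eq: "std_normal_density x * exp (- (s * x\<^sup>2)) = \<tau> * normal_density 0 \<tau> x" for x
  proof -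
    have "sqrt (2 * pi * \<tau>\<^sup>2) = \<tau> * sqrt (2 * pi)" using \<tau>(1) by (simp add: real_sqrt_mult)
    moreover have "exp (- (x - 0)\<^sup>2 / (2 * \<tau>\<^sup>2)) = exp (- x\<^sup>2 / 2) * exp (- (s * x\<^sup>2))"
      unfolding exp_add[symmetric] using s by (simp add: \<tau>(2) field_simps)
    ultimately show ?thesis using \<tau>(1) by (simp add: normal_density_def std_normal_density_def)
  qed
  have "(LINT x|std_normal_distribution. exp (- (s * x\<^sup>2))) = (LINT x|lborel. std_normal_density x * exp (- (s * x\<^sup>2)))"
    by (subst integral_density) (auto simp: normal_density_nonneg)
  also have "\<dots> = \<tau>" unfolding eq using integral_normal_density[OF \<tau>(1), of 0] by simp
  also have "\<dots> = (1 + 2 * s) powr (- 1 / 2)"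
    using s powr_minus_divide[of "1 + 2 * s" "1 / 2"] by (simp add: \<tau>_def powr_half_sqrt)
  finally show ?thesis .
qed

text \<open>The function \<open>exp (- a |x|\<^sup>2)\<close> is itself the mean of \<open>iexp (\<xi> \<bullet> x)\<close> over a centred normal vector \<open>\<xi>\<close>
  whose coordinates have variance \<open>2 a\<close>. Exchanging the two expectations leaves the mean of
  \<open>exp (- t |\<xi>|\<^sup>2)\<close>, a product of one-dimensional integrals.\<close>

lemma expectation_gaussian:
  fixes W :: "'w \<Rightarrow> 'a::euclidean_space"
  assumes "prob_space P" and W [measurable]: "W \<in> borel_measurable P" and "0 \<le> t" "0 \<le> a"
    and char: "\<And>\<xi>. (CLINT \<omega>|P. iexp (\<xi> \<bullet> W \<omega>)) = complex_of_real (exp (- t * (norm \<xi>)\<^sup>2))"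
  shows "(LINT \<omega>|P. exp (- (a * (norm (W \<omega>))\<^sup>2))) = (1 + 4 * a * t) powr (- real DIM('a) / 2)"
proof -
  interpret prob_space P by fact
  interpret N: real_distribution std_normal_distribution by (rule real_dist_normal_dist)
  interpret product_sigma_finite "\<lambda>_::'a. std_normal_distribution" ..
  define \<nu> where "\<nu> = PiM (Basis :: 'a set) (\<lambda>_. std_normal_distribution)"
  interpret \<nu>: prob_space \<nu> unfolding \<nu>_def by (intro prob_space_PiM N.prob_space_axioms)
  interpret pair_prob_space P \<nu> ..
  have [measurable]: "(\<lambda>w. w b) \<in> borel_measurable \<nu>" if "b \<in> Basis" for b
    unfolding \<nu>_def using measurable_component_singleton[OF that, of "\<lambda>_. std_normal_distribution"] by simp
  define \<xi> :: "('a \<Rightarrow> real) \<Rightarrow> 'a" where "\<xi> w = (\<Sum>b\<in>Basis. (sqrt (2 * a) * w b) *\<^sub>R b)" for w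
  have [measurable]: "\<xi> \<in> borel_measurable \<nu>" unfolding \<xi>_def by measurable
  have in1: "\<xi> w \<bullet> x = (\<Sum>b\<in>Basis. (sqrt (2 * a) * (x \<bullet> b)) * w b)" for w x
    unfolding \<xi>_def inner_sum_left inner_scaleR_left by (intro sum.cong) (auto simp: inner_commute)
  have nrm: "(norm (\<xi> w))\<^sup>2 = (\<Sum>b\<in>Basis. 2 * a * (w b)\<^sup>2)" for w
  proof -
    have "\<xi> w \<bullet> b = sqrt (2 * a) * w b" if "b \<in> Basis" for b
      unfolding \<xi>_def using that by (simp add: inner_sum_left_Basis)
    then show ?thesis unfolding power2_norm_eq_inner euclidean_inner[of "\<xi> w" "\<xi> w"]
      using assms(4) by (intro sum.cong) (auto simp: power2_eq_square real_sqrt_mult[symmetric] algebra_simps)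
  qed
  have g: "(CLINT w|\<nu>. iexp (\<xi> w \<bullet> x)) = complex_of_real (exp (- (a * (norm x)\<^sup>2)))" for x
  proof -
    have "(\<Sum>b\<in>Basis. (sqrt (2 * a) * (x \<bullet> b))\<^sup>2) = 2 * a * (norm x)\<^sup>2"
      unfolding power2_norm_eq_inner euclidean_inner[of x x] sum_distrib_left
      using assms(4) by (intro sum.cong) (auto simp: power_mult_distrib power2_eq_square[of "x \<bullet> _"])
    then show ?thesis unfolding in1 \<nu>_def by (subst char_product_normal) auto
  qed
  have "complex_of_real (LINT \<omega>|P. exp (- (a * (norm (W \<omega>))\<^sup>2))) = (CLINT \<omega>|P. CLINT w|\<nu>. iexp (\<xi> w \<bullet> W \<omega>))"
    unfolding g by (rule integral_complex_of_real[symmetric])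
  also have "\<dots> = (CLINT w|\<nu>. CLINT \<omega>|P. iexp (\<xi> w \<bullet> W \<omega>))"
  proof (rule Fubini_integral[symmetric])
    show "integrable (P \<Otimes>\<^sub>M \<nu>) (\<lambda>(\<omega>, w). iexp (\<xi> w \<bullet> W \<omega>))"
      by (intro P.integrable_const_bound[of _ 1] AE_I2) (auto simp: split_beta)
  qed
  also have "\<dots> = (CLINT w|\<nu>. complex_of_real (exp (- (\<Sum>b\<in>Basis. (2 * a * t) * (w b)\<^sup>2))))"
    unfolding char nrm by (simp add: sum_distrib_left sum_negf mult_ac)
  also have "\<dots> = complex_of_real (LINT w|\<nu>. exp (- (\<Sum>b\<in>Basis. (2 * a * t) * (w b)\<^sup>2)))"
    by (rule integral_complex_of_real)
  also have "(LINT w|\<nu>. exp (- (\<Sum>b\<in>Basis. (2 * a * t) * (w b)\<^sup>2))) =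
      (LINT w|\<nu>. (\<Prod>b\<in>Basis. exp (- ((2 * a * t) * (w b)\<^sup>2))))"
    by (simp only: sum_negf[symmetric] exp_sum finite_Basis)
  also have "\<dots> = (\<Prod>b\<in>(Basis::'a set). LINT x|std_normal_distribution. exp (- ((2 * a * t) * x\<^sup>2)))"
    unfolding \<nu>_def
  proof (rule product_integral_prod)
    show "integrable std_normal_distribution (\<lambda>x. exp (- ((2 * a * t) * x\<^sup>2)))"
      using assms by (intro N.integrable_const_bound[of _ 1] AE_I2) auto
  qed simp
  also have "\<dots> = ((1 + 2 * (2 * a * t)) powr (- 1 / 2)) ^ DIM('a)"
    using assms by (subst integral_exp_square_normal) auto
  also have "\<dots> = (1 + 4 * a * t) powr (- real DIM('a) / 2)"
  proof -
    have "0 < 1 + 2 * (2 * a * t)" using assms by (simp add: add_pos_nonneg)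
    then have "((1 + 2 * (2 * a * t)) powr (- 1 / 2)) ^ DIM('a) = (1 + 2 * (2 * a * t)) powr (- 1 / 2 * real DIM('a))"
      by (subst powr_realpow[symmetric]) (simp_all add: powr_powr)
    then show ?thesis by (simp add: mult_ac)
  qed
  finally show ?thesis using of_real_eq_iff by blast
qed

section \<open>Second moments and transience\<close>

lemma levy_process_expectation_increment:
  fixes f :: "'a::euclidean_space \<Rightarrow> real"
  assumes X: "levy_process P 0 X" and f [measurable]: "f \<in> borel_measurable borel"
    and "0 \<le> s" "s \<le> t"
  shows "(LINT \<omega>|P. f (X t \<omega> - X s \<omega>)) = (LINT \<omega>|P. f (X (t - s) \<omega>))"
proof -
  have [measurable]: "X t \<in> borel_measurable P" "X s \<in> borel_measurable P" "X (t - s) \<in> borel_measurable P"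
    using levy_processD(2)[OF X] assms by auto
  have "(LINT \<omega>|P. f (X t \<omega> - X s \<omega>)) = (LINT x|distr P borel (\<lambda>\<omega>. X t \<omega> - X s \<omega>). f x)"
    by (subst integral_distr) auto
  also have "\<dots> = (LINT \<omega>|P. f (X (t - s) \<omega>))"
    unfolding levy_process_distr_increment[OF X assms(3,4)] by (subst integral_distr) auto
  finally show ?thesis .
qed

lemma levy_process_two_time:
  fixes f :: "'a::euclidean_space \<Rightarrow> real"
  assumes X: "levy_process P 0 X" and f [measurable]: "f \<in> borel_measurable borel"
    and f01: "\<And>x. 0 \<le> f x" "\<And>x. f x \<le> 1" and st: "0 \<le> s" "s \<le> t"
  shows "(LINT \<omega>|P. f (X s \<omega>) * f (X t \<omega> - X s \<omega>)) = (LINT \<omega>|P. f (X s \<omega>)) * (LINT \<omega>|P. f (X (t - s) \<omega>))"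
proof -
  interpret prob_space P using levy_processD(1)[OF X] .
  have [measurable]: "X t \<in> borel_measurable P" "X s \<in> borel_measurable P" "X 0 \<in> borel_measurable P"
    using levy_processD[OF X] st by auto
  define T :: "nat \<Rightarrow> real" where "T i = (if i = 0 then 0 else if i = 1 then s else t)" for i
  have T: "T 0 = 0" "T (Suc 0) = s" "T (Suc (Suc 0)) = t" by (auto simp: T_def)
  have Tm: "\<forall>i<2. T i \<le> T (Suc i)" using st by (auto simp: T_def)
  have ii: "independent_increments P X" using levy_processD(4)[OF X] .
  have "indep_vars (\<lambda>_. borel) (\<lambda>i \<omega>. X (T (Suc i)) \<omega> - X (T i) \<omega>) {..<2}"
    using ii[unfolded independent_increments_def, rule_format, of T 2] Tm T(1) by simp
  then have iv: "indep_vars (\<lambda>_. borel) (\<lambda>i \<omega>. f (X (T (Suc i)) \<omega> - X (T i) \<omega>)) {..<2}"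
    by (rule indep_vars_compose2) simp
  have [measurable]: "X (T i) \<in> borel_measurable P" for i using st by (auto simp: T_def)
  have "(LINT \<omega>|P. (\<Prod>i<2. f (X (T (Suc i)) \<omega> - X (T i) \<omega>))) = (\<Prod>i<2. LINT \<omega>|P. f (X (T (Suc i)) \<omega> - X (T i) \<omega>))"
    using f01 by (intro indep_vars_lebesgue_integral[OF _ iv] integrable_const_bound[of _ 1] AE_I2) auto
  then have "(LINT \<omega>|P. f (X s \<omega> - X 0 \<omega>) * f (X t \<omega> - X s \<omega>)) =
      (LINT \<omega>|P. f (X s \<omega> - X 0 \<omega>)) * (LINT \<omega>|P. f (X t \<omega> - X s \<omega>))"
    by (simp add: numeral_2_eq_2 T)
  moreover have "(LINT \<omega>|P. f (X s \<omega> - X 0 \<omega>) * f (X t \<omega> - X s \<omega>)) = (LINT \<omega>|P. f (X s \<omega>) * f (X t \<omega> - X s \<omega>))"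
    using levy_processD(3)[OF X] by (intro integral_cong_AE) auto
  ultimately show ?thesis
    using levy_process_expectation_increment[OF X f, of s t] levy_process_expectation_increment[OF X f, of 0 s] st by simp
qed

text \<open>This bounds the expected number of pairs of visits by the square of the expected number of visits.\<close>

lemma sum_convolution_le:
  fixes a :: "nat \<Rightarrow> real"
  assumes "\<And>k. 0 \<le> a k"
  shows "(\<Sum>j<n. \<Sum>k<n. if j \<le> k then a j * a (k - j) else 0) \<le> (\<Sum>k<n. a k)\<^sup>2"
proof -
  have "(\<Sum>k<n. if j \<le> k then a j * a (k - j) else 0) \<le> a j * (\<Sum>k<n. a k)" if "j < n" for j
  proof -
    have "(\<Sum>k<n. if j \<le> k then a j * a (k - j) else 0) = (\<Sum>k\<in>{j..<n}. a j * a (k - j))"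
      by (intro sum.mono_neutral_cong_right) auto
    also have "\<dots> = (\<Sum>i<n - j. a j * a i)"
      using that by (intro sum.reindex_bij_witness[of _ "\<lambda>i. i + j" "\<lambda>k. k - j"]) auto
    also have "\<dots> \<le> (\<Sum>k<n. a j * a k)" using assms by (intro sum_mono2) auto
    finally show ?thesis by (simp add: sum_distrib_left)
  qed
  then have "(\<Sum>j<n. \<Sum>k<n. if j \<le> k then a j * a (k - j) else 0) \<le> (\<Sum>j<n. a j * (\<Sum>k<n. a k))"
    by (intro sum_mono) auto
  then show ?thesis by (simp add: power2_eq_square sum_distrib_right)
qed

text \<open>Let \<open>N\<close> be the number of indices \<open>k < n\<close> with \<open>|Y k| \<le> R\<close>, and \<open>A\<close> the sum of the first \<open>n\<close> terms
  of \<open>a\<close>. Comparing the indicator of the ball with Gaussian functions gives \<open>E N \<ge> A / 2\<close> and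
  \<open>E N\<^sup>2 \<le> C' A\<^sup>2\<close>, with \<open>C'\<close> independent of \<open>n\<close>. By transience there is a time \<open>K\<close> after which the
  ball is visited only with a small probability; off this event \<open>N \<le> K\<close>, and on it the second moment
  bound makes the contribution to \<open>E N\<close> at most \<open>A / 4\<close>. Hence \<open>A \<le> 4 K\<close> for all \<open>n\<close>.\<close>

lemma (in prob_space) transient_imp_bounded_partial_sums:
  fixes Y :: "nat \<Rightarrow> 'a \<Rightarrow> 'b::euclidean_space" and a :: "nat \<Rightarrow> real"
  assumes Y [measurable]: "\<And>k. Y k \<in> borel_measurable M"
    and a: "\<And>k. 0 \<le> a k"
    and two: "\<And>j k. j \<le> k \<Longrightarrow> expectation (\<lambda>\<omega>. exp (- (norm (Y j \<omega>))\<^sup>2) * exp (- (norm (Y k \<omega> - Y j \<omega>))\<^sup>2)) = a j * a (k - j)"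
    and one: "\<And>k. expectation (\<lambda>\<omega>. exp (- (norm (Y k \<omega>))\<^sup>2)) = a k"
    and half: "\<And>k. expectation (\<lambda>\<omega>. exp (- ((norm (Y k \<omega>))\<^sup>2 / 2))) \<le> C * a k"
    and trans: "AE \<omega> in M. filterlim (\<lambda>k. norm (Y k \<omega>)) at_top sequentially"
  obtains H where "\<And>n. (\<Sum>k<n. a k) \<le> H"
proof -
  (* The radius is so large that at least half of the Gaussian mean comes from inside the ball. *)
  obtain R where R: "0 \<le> R" "exp (- (R\<^sup>2 / 2)) * C \<le> 1 / 2"
  proof -
    define R where "R = sqrt (2 * ln (1 + 2 * \<bar>C\<bar>))"
    have u: "1 + 2 * \<bar>C\<bar> > 0" "0 \<le> ln (1 + 2 * \<bar>C\<bar>)" by auto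
    then have "exp (- (R\<^sup>2 / 2)) = inverse (1 + 2 * \<bar>C\<bar>)" by (simp add: R_def exp_minus)
    moreover have "inverse (1 + 2 * \<bar>C\<bar>) * C \<le> 1 / 2" using u(1) by (simp add: field_simps)
    ultimately have "exp (- (R\<^sup>2 / 2)) * C \<le> 1 / 2" by simp
    moreover have "0 \<le> R" using u by (simp add: R_def)
    ultimately show thesis by (intro that[of R])
  qed
  define I where "I k \<omega> = (indicator {\<omega>. norm (Y k \<omega>) \<le> R} \<omega> :: real)" for k \<omega>
  have [measurable]: "I k \<in> borel_measurable M" for k unfolding I_def indicator_def by simp
  have I01: "0 \<le> I k \<omega>" "I k \<omega> \<le> 1" for k \<omega> by (auto simp: I_def)
  have integ: "integrable M f" if "f \<in> borel_measurable M" "\<And>\<omega>. 0 \<le> f \<omega>" "\<And>\<omega>. f \<omega> \<le> c" for f :: "'a \<Rightarrow> real" and c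
    using that by (intro integrable_const_bound[of _ c] AE_I2) auto
  have EI: "a k / 2 \<le> expectation (I k)" for k
  proof -
    have "a k / 2 \<le> a k - exp (- (R\<^sup>2 / 2)) * (C * a k)"
      using mult_right_mono[OF R(2) a[of k]] by (simp add: mult_ac)
    also have "\<dots> \<le> a k - exp (- (R\<^sup>2 / 2)) * expectation (\<lambda>\<omega>. exp (- ((norm (Y k \<omega>))\<^sup>2 / 2)))"
      using half[of k] by simp
    also have "\<dots> = expectation (\<lambda>\<omega>. exp (- (norm (Y k \<omega>))\<^sup>2) - exp (- (R\<^sup>2 / 2)) * exp (- ((norm (Y k \<omega>))\<^sup>2 / 2)))"
      unfolding one[symmetric]
      by (subst Bochner_Integration.integral_diff) (auto intro!: integ[of _ 1] integrable_mult_right)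
    also have "\<dots> \<le> expectation (I k)"
    proof (rule integral_mono)
      show "integrable M (I k)" using I01 by (intro integ[of _ 1]) auto
      show "integrable M (\<lambda>\<omega>. exp (- (norm (Y k \<omega>))\<^sup>2) - exp (- (R\<^sup>2 / 2)) * exp (- ((norm (Y k \<omega>))\<^sup>2 / 2)))"
        by (intro Bochner_Integration.integrable_diff integrable_mult_right integ[of _ 1]) auto
      fix \<omega>
      show "exp (- (norm (Y k \<omega>))\<^sup>2) - exp (- (R\<^sup>2 / 2)) * exp (- ((norm (Y k \<omega>))\<^sup>2 / 2)) \<le> I k \<omega>"
      proof (cases "norm (Y k \<omega>) \<le> R")
        case True
        have "exp (- (norm (Y k \<omega>))\<^sup>2) \<le> 1" by simp
        moreover have "0 \<le> exp (- (R\<^sup>2 / 2)) * exp (- ((norm (Y k \<omega>))\<^sup>2 / 2))" by simp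
        moreover have "I k \<omega> = 1" using True by (simp add: I_def)
        ultimately show ?thesis by linarith
      next
        case False
        have "R\<^sup>2 \<le> (norm (Y k \<omega>))\<^sup>2" using False R by (intro power_mono) auto
        then have "exp (- (norm (Y k \<omega>))\<^sup>2) \<le> exp (- (R\<^sup>2 / 2)) * exp (- ((norm (Y k \<omega>))\<^sup>2 / 2))"
          unfolding exp_add[symmetric] by simp
        then show ?thesis using False by (simp add: I_def)
      qed
    qed
    finally show ?thesis .
  qed
  (* If both points lie in the ball, then |Y j|^2 + |Y k - Y j|^2 \<le> R^2 + (2 R)^2. *)
  define E where "E = exp (5 * R\<^sup>2)"
  have E: "E > 0" by (simp add: E_def)
  have EII: "expectation (\<lambda>\<omega>. I j \<omega> * I k \<omega>) \<le> E * (a j * a (k - j))" if "j \<le> k" for j k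
  proof -
    have "expectation (\<lambda>\<omega>. I j \<omega> * I k \<omega>) \<le>
       expectation (\<lambda>\<omega>. E * (exp (- (norm (Y j \<omega>))\<^sup>2) * exp (- (norm (Y k \<omega> - Y j \<omega>))\<^sup>2)))"
    proof (rule integral_mono)
      show "integrable M (\<lambda>\<omega>. I j \<omega> * I k \<omega>)" using I01 by (intro integ[of _ 1]) (auto intro!: mult_le_one)
      show "integrable M (\<lambda>\<omega>. E * (exp (- (norm (Y j \<omega>))\<^sup>2) * exp (- (norm (Y k \<omega> - Y j \<omega>))\<^sup>2)))"
        by (intro integrable_mult_right integ[of _ 1]) (auto intro!: mult_le_one)
      fix \<omega>
      show "I j \<omega> * I k \<omega> \<le> E * (exp (- (norm (Y j \<omega>))\<^sup>2) * exp (- (norm (Y k \<omega> - Y j \<omega>))\<^sup>2))"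
      proof (cases "norm (Y j \<omega>) \<le> R \<and> norm (Y k \<omega>) \<le> R")
        case True
        have "norm (Y k \<omega> - Y j \<omega>) \<le> 2 * R" using True norm_triangle_ineq4[of "Y k \<omega>" "Y j \<omega>"] by linarith
        then have "(norm (Y k \<omega> - Y j \<omega>))\<^sup>2 \<le> (2 * R)\<^sup>2" by (intro power_mono) auto
        moreover have "(norm (Y j \<omega>))\<^sup>2 \<le> R\<^sup>2" using True by (intro power_mono) auto
        ultimately have "0 \<le> 5 * R\<^sup>2 + (- (norm (Y j \<omega>))\<^sup>2 + - (norm (Y k \<omega> - Y j \<omega>))\<^sup>2)"
          by (simp add: power_mult_distrib)
        then have "1 \<le> E * (exp (- (norm (Y j \<omega>))\<^sup>2) * exp (- (norm (Y k \<omega> - Y j \<omega>))\<^sup>2))"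
          unfolding E_def exp_add[symmetric] by (simp only: one_le_exp_iff)
        then show ?thesis using I01[of j \<omega>] I01[of k \<omega>] mult_le_one[of "I j \<omega>" "I k \<omega>"] by linarith
      next
        case False
        then have z: "I j \<omega> * I k \<omega> = 0" by (auto simp: I_def)
        show ?thesis unfolding z using E by simp
      qed
    qed
    also have "\<dots> = E * (a j * a (k - j))" using two[OF that] by simp
    finally show ?thesis .
  qed
  define D where "D K = {\<omega>\<in>space M. \<exists>k\<ge>K. norm (Y k \<omega>) \<le> R}" for K :: nat
  have [measurable]: "D K \<in> sets M" for K unfolding D_def by measurable
  have "(\<lambda>K. prob (D K)) \<longlonglongrightarrow> 0"
  proof -
    have "(\<lambda>K. expectation (indicator (D K) :: 'a \<Rightarrow> real)) \<longlonglongrightarrow> expectation (\<lambda>_. 0 :: real)"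
    proof (rule integral_dominated_convergence[where w = "\<lambda>_. 1"])
      show "AE \<omega> in M. (\<lambda>K. indicator (D K) \<omega> :: real) \<longlonglongrightarrow> 0"
        using trans
      proof eventually_elim
        fix \<omega> assume "filterlim (\<lambda>k. norm (Y k \<omega>)) at_top sequentially"
        then have "\<forall>\<^sub>F k in sequentially. R < norm (Y k \<omega>)" by (simp add: filterlim_at_top_dense)
        then obtain K0 where K0: "\<And>k. K0 \<le> k \<Longrightarrow> R < norm (Y k \<omega>)" by (auto simp: eventually_sequentially)
        have "\<forall>\<^sub>F K in sequentially. indicator (D K) \<omega> = (0::real)"
          unfolding eventually_sequentially D_def
        proof (intro exI[of _ K0] allI impI)
          fix K assume "K0 \<le> K"
          then show "indicator {\<omega> \<in> space M. \<exists>k\<ge>K. norm (Y k \<omega>) \<le> R} \<omega> = (0::real)"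
            using K0 by (auto simp: indicator_def not_le[symmetric] intro: le_trans)
        qed
        then show "(\<lambda>K. indicator (D K) \<omega> :: real) \<longlonglongrightarrow> 0" by (rule tendsto_eventually)
      qed
    qed auto
    then show ?thesis by simp
  qed
  moreover have "0 < 1 / (32 * E)" using E by simp
  ultimately have "\<forall>\<^sub>F K in sequentially. prob (D K) < 1 / (32 * E)" by (rule order_tendstoD(2))
  then obtain K where K: "prob (D K) < 1 / (32 * E)" by (auto simp: eventually_sequentially)
  show thesis
  proof (rule that[of "4 * real K"])
    fix n
    define A where "A = (\<Sum>k<n. a k)"
    have "0 \<le> A" using a by (auto simp: A_def intro: sum_nonneg)
    show "(\<Sum>k<n. a k) \<le> 4 * real K"
    proof (cases "A = 0")
      case False
      then have A: "A > 0" using \<open>0 \<le> A\<close> by simp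
      define N where "N \<omega> = (\<Sum>k<n. I k \<omega>)" for \<omega>
      have [measurable]: "N \<in> borel_measurable M" unfolding N_def by measurable
      have N0: "0 \<le> N \<omega>" for \<omega> unfolding N_def by (intro sum_nonneg I01)
      have Nn: "N \<omega> \<le> real n" for \<omega>
        using sum_mono[of "{..<n}" "\<lambda>k. I k \<omega>" "\<lambda>_. 1"] I01 by (simp add: N_def)
      have Ii: "integrable M (I k)" for k using I01 by (intro integ[of _ 1]) auto
      have IIi: "integrable M (\<lambda>\<omega>. I j \<omega> * I k \<omega>)" for j k using I01 by (intro integ[of _ 1]) (auto intro!: mult_le_one)
      have N2i: "integrable M (\<lambda>\<omega>. (N \<omega>)\<^sup>2)"
        using N0 Nn by (intro integ[of _ "(real n)\<^sup>2"]) (auto intro!: power_mono)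
      have Di: "integrable M (indicator (D K) :: 'a \<Rightarrow> real)" by (intro integ[of _ 1]) (auto simp: indicator_def)
      have EN: "A / 2 \<le> expectation N"
      proof -
        have "A / 2 = (\<Sum>k<n. a k / 2)" by (simp add: A_def sum_divide_distrib)
        also have "\<dots> \<le> (\<Sum>k<n. expectation (I k))" by (intro sum_mono EI)
        also have "\<dots> = expectation N" unfolding N_def using Ii by simp
        finally show ?thesis .
      qed
      have EN2: "expectation (\<lambda>\<omega>. (N \<omega>)\<^sup>2) \<le> 2 * E * A\<^sup>2"
      proof -
        have "expectation (\<lambda>\<omega>. (N \<omega>)\<^sup>2) = expectation (\<lambda>\<omega>. \<Sum>j<n. \<Sum>k<n. I j \<omega> * I k \<omega>)"
          by (simp add: N_def power2_eq_square sum_product)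
        also have "\<dots> = (\<Sum>j<n. \<Sum>k<n. expectation (\<lambda>\<omega>. I j \<omega> * I k \<omega>))"
          using IIi by (simp add: Bochner_Integration.integral_sum)
        also have "\<dots> \<le> (\<Sum>j<n. \<Sum>k<n. E * (if j \<le> k then a j * a (k - j) else 0) + E * (if k \<le> j then a k * a (j - k) else 0))"
        proof (intro sum_mono)
          fix j k
          have e: "0 \<le> E * (a x * a y)" for x y using E a by simp
          show "expectation (\<lambda>\<omega>. I j \<omega> * I k \<omega>) \<le> E * (if j \<le> k then a j * a (k - j) else 0) + E * (if k \<le> j then a k * a (j - k) else 0)"
          proof (cases "j \<le> k")
            case True
            have "0 \<le> E * (if k \<le> j then a k * a (j - k) else 0)" using e by simp
            then show ?thesis using EII[OF True] True by simp
          next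
            case False
            then have "k \<le> j" by simp
            then show ?thesis using EII[OF \<open>k \<le> j\<close>] False by (simp add: mult.commute[of "I j _"])
          qed
        qed
        also have "\<dots> = 2 * E * (\<Sum>j<n. \<Sum>k<n. if j \<le> k then a j * a (k - j) else 0)"
        proof -
          have "(\<Sum>j<n. \<Sum>k<n. if k \<le> j then a k * a (j - k) else 0) = (\<Sum>j<n. \<Sum>k<n. if j \<le> k then a j * a (k - j) else 0)"
            by (rule sum.swap)
          then show ?thesis by (simp only: sum.distrib sum_distrib_left[symmetric] mult_2 distrib_right)
        qed
        also have "\<dots> \<le> 2 * E * A\<^sup>2" unfolding A_def using E by (intro mult_left_mono sum_convolution_le a) auto
        finally show ?thesis .
      qed
      (* On the event D K use N \<le> \<beta> N^2 + 1 / (4 \<beta>); with this \<beta>, both terms have mean at most A / 8. *)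
      define \<beta> where "\<beta> = 1 / (16 * E * A)"
      have \<beta>: "\<beta> > 0" using E A by (simp add: \<beta>_def)
      have "expectation N \<le> expectation (\<lambda>\<omega>. real K + (\<beta> * (N \<omega>)\<^sup>2 + 1 / (4 * \<beta>) * indicator (D K) \<omega>))"
      proof (rule integral_mono_AE)
        show "integrable M N" unfolding N_def using Ii by simp
        show "integrable M (\<lambda>\<omega>. real K + (\<beta> * (N \<omega>)\<^sup>2 + 1 / (4 * \<beta>) * indicator (D K) \<omega>))"
          using N2i Di by (intro Bochner_Integration.integrable_add integrable_mult_right) auto
        show "AE \<omega> in M. N \<omega> \<le> real K + (\<beta> * (N \<omega>)\<^sup>2 + 1 / (4 * \<beta>) * indicator (D K) \<omega>)"
        proof (rule AE_I2)
          fix \<omega> assume \<omega>: "\<omega> \<in> space M"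
          show "N \<omega> \<le> real K + (\<beta> * (N \<omega>)\<^sup>2 + 1 / (4 * \<beta>) * indicator (D K) \<omega>)"
          proof (cases "\<omega> \<in> D K")
            case True
            have "0 \<le> (2 * \<beta> * N \<omega> - 1)\<^sup>2" by simp
            then have "4 * \<beta> * N \<omega> \<le> 4 * \<beta>\<^sup>2 * (N \<omega>)\<^sup>2 + 1" by (simp add: power2_eq_square algebra_simps)
            then have "N \<omega> \<le> \<beta> * (N \<omega>)\<^sup>2 + 1 / (4 * \<beta>)" using \<beta> by (simp add: field_simps power2_eq_square)
            then show ?thesis using True by simp
          next
            case False
            have "N \<omega> \<le> (\<Sum>k<n. if k < K then 1 else 0)" unfolding N_def
            proof (intro sum_mono)
              fix k
              show "I k \<omega> \<le> (if k < K then 1 else 0)"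
                using False \<omega> by (auto simp: I_def D_def indicator_def)
            qed
            also have "\<dots> = real (card {k. k < n \<and> k < K})" by (simp add: sum.If_cases Int_def)
            also have "\<dots> \<le> real (card {..<K})" by (intro of_nat_mono card_mono) auto
            finally show ?thesis using \<beta> by (simp add: add_increasing2)
          qed
        qed
      qed
      also have "\<dots> = real K + (\<beta> * expectation (\<lambda>\<omega>. (N \<omega>)\<^sup>2) + 1 / (4 * \<beta>) * prob (D K))"
        using N2i Di by (simp add: prob_space)
      also have "\<dots> \<le> real K + (\<beta> * (2 * E * A\<^sup>2) + 1 / (4 * \<beta>) * (1 / (32 * E)))"
        using EN2 K \<beta> by (intro add_mono mult_left_mono) auto
      also have "\<beta> * (2 * E * A\<^sup>2) + 1 / (4 * \<beta>) * (1 / (32 * E)) = A / 4"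
        using E A by (simp add: \<beta>_def power2_eq_square)
      finally have "A \<le> 4 * real K" using EN by linarith
      then show ?thesis by (simp add: A_def)
    qed (simp add: A_def)
  qed
qed

section \<open>Conditioning on an independent discrete time\<close>

lemma (in prob_space) nn_integral_indep_mult:
  assumes ind: "indep_set \<A> \<B>"
    and A: "sigma_algebra (space M) \<A>" and B: "sigma_algebra (space M) \<B>"
    and F: "F \<in> sigma (space M) \<A> \<rightarrow>\<^sub>M borel" and G: "G \<in> sigma (space M) \<B> \<rightarrow>\<^sub>M borel"
  shows "(\<integral>\<^sup>+\<omega>. (F \<omega> :: ennreal) * G \<omega> \<partial>M) = (\<integral>\<^sup>+\<omega>. F \<omega> \<partial>M) * (\<integral>\<^sup>+\<omega>. G \<omega> \<partial>M)"
proof -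
  have ev: "\<A> \<subseteq> events" "\<B> \<subseteq> events" using ind by (auto simp: indep_set_def indep_sets_def UNIV_bool split: bool.split_asm)
  have meas: "{X -` S \<inter> space M |S. S \<in> sets borel} \<subseteq> \<C>" 
    if "X \<in> sigma (space M) \<C> \<rightarrow>\<^sub>M borel" "sigma_algebra (space M) \<C>" for X :: "'a \<Rightarrow> ennreal" and \<C>
  proof -
    interpret C: sigma_algebra "space M" \<C> by fact
    have "sets (sigma (space M) \<C>) = \<C>" "space (sigma (space M) \<C>) = space M"
      using C.space_closed by (auto simp: sets_measure_of space_measure_of C.sigma_sets_eq)
    then show ?thesis using measurable_sets[OF that(1)] by auto
  qed
  have rv: "X \<in> borel_measurable M"
    if "X \<in> sigma (space M) \<C> \<rightarrow>\<^sub>M borel" "sigma_algebra (space M) \<C>" "\<C> \<subseteq> events" for X :: "'a \<Rightarrow> ennreal" and \<C>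
    using meas[OF that(1,2)] that(3) by (intro measurableI) auto
  have sub: "sigma_sets (space M) {X -` S \<inter> space M |S. S \<in> sets borel} \<subseteq> \<C>"
    if "X \<in> sigma (space M) \<C> \<rightarrow>\<^sub>M borel" "sigma_algebra (space M) \<C>" for X :: "'a \<Rightarrow> ennreal" and \<C>
    using meas[OF that] sigma_algebra.sigma_sets_subset[OF that(2)] by blast
  have "indep_var borel F borel G"
    unfolding indep_var_eq
  proof (intro conjI)
    show "indep_set (sigma_sets (space M) {F -` A \<inter> space M |A. A \<in> sets borel}) (sigma_sets (space M) {G -` A \<inter> space M |A. A \<in> sets borel})"
      using ind sub[OF F A] sub[OF G B] unfolding indep_set_def
      by (elim indep_sets_mono_sets) (auto split: bool.split)
  qed (use rv[OF F A ev(1)] rv[OF G B ev(2)] in auto)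
  moreover have "case_bool borel borel = (\<lambda>_::bool. borel :: ennreal measure)" by (auto split: bool.split)
  ultimately have "indep_vars (\<lambda>_. borel) (case_bool F G) UNIV" unfolding indep_var_def by simp
  from indep_vars_nn_integral[OF _ this] show ?thesis by (simp add: UNIV_bool mult.commute)
qed

text \<open>Evaluating an independent family at a random index amounts to averaging over the index. As the
  index takes countably many values, no joint measurability is involved.\<close>

lemma (in prob_space) nn_integral_indep_countable_mixture:
  fixes F :: "nat \<Rightarrow> 'a \<Rightarrow> ennreal" and N :: "'a \<Rightarrow> nat"
  assumes ind: "indep_set \<A> \<B>"
    and A: "sigma_algebra (space M) \<A>" and B: "sigma_algebra (space M) \<B>"
    and F: "\<And>n. F n \<in> sigma (space M) \<A> \<rightarrow>\<^sub>M borel" and N: "N \<in> sigma (space M) \<B> \<rightarrow>\<^sub>M count_space UNIV"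
    and FM [measurable]: "\<And>n. F n \<in> borel_measurable M" and NM [measurable]: "N \<in> M \<rightarrow>\<^sub>M count_space UNIV"
  shows "(\<integral>\<^sup>+\<omega>. F (N \<omega>) \<omega> \<partial>M) = (\<integral>\<^sup>+\<omega>. (\<integral>\<^sup>+\<omega>'. F (N \<omega>) \<omega>' \<partial>M) \<partial>M)"
proof -
  (* Splitting according to the value m of the index. *)
  have single: "(\<Sum>n. f n * indicator {n} m) = f m" for f :: "nat \<Rightarrow> ennreal" and m
    by (subst suminf_finite[of "{m}"]) auto
  have [measurable]: "(\<lambda>\<omega>. indicator {n} (N \<omega>) :: ennreal) \<in> borel_measurable M" for n
    by (rule measurable_compose[OF NM]) simp
  have "(\<integral>\<^sup>+\<omega>. F (N \<omega>) \<omega> \<partial>M) = (\<integral>\<^sup>+\<omega>. (\<Sum>n. F n \<omega> * indicator {n} (N \<omega>)) \<partial>M)"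
    by (intro nn_integral_cong) (rule single[symmetric])
  also have "\<dots> = (\<Sum>n. \<integral>\<^sup>+\<omega>. F n \<omega> * indicator {n} (N \<omega>) \<partial>M)"
    by (rule nn_integral_suminf) measurable
  also have "\<dots> = (\<Sum>n. \<integral>\<^sup>+\<omega>. (\<integral>\<^sup>+\<omega>'. F n \<omega>' \<partial>M) * indicator {n} (N \<omega>) \<partial>M)"
  proof (intro suminf_cong)
    fix n
    have "(\<lambda>\<omega>. indicator {n} (N \<omega>) :: ennreal) \<in> sigma (space M) \<B> \<rightarrow>\<^sub>M borel"
      by (rule measurable_compose[OF N]) simp
    from nn_integral_indep_mult[OF ind A B F this]
    show "(\<integral>\<^sup>+\<omega>. F n \<omega> * indicator {n} (N \<omega>) \<partial>M) = (\<integral>\<^sup>+\<omega>. (\<integral>\<^sup>+\<omega>'. F n \<omega>' \<partial>M) * indicator {n} (N \<omega>) \<partial>M)"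
      by (simp add: nn_integral_cmult)
  qed
  also have "\<dots> = (\<integral>\<^sup>+\<omega>. (\<Sum>n. (\<integral>\<^sup>+\<omega>'. F n \<omega>' \<partial>M) * indicator {n} (N \<omega>)) \<partial>M)"
    by (rule nn_integral_suminf[symmetric]) measurable
  also have "\<dots> = (\<integral>\<^sup>+\<omega>. (\<integral>\<^sup>+\<omega>'. F (N \<omega>) \<omega>' \<partial>M) \<partial>M)"
    by (intro nn_integral_cong single)
  finally show ?thesis .
qed

text \<open>The conversion to a natural number sends negative \<open>s\<close> to \<open>0\<close>, so that every value is an admissible
  time for \<open>B\<close>.\<close>

definition dyadic_ceiling :: "nat \<Rightarrow> real \<Rightarrow> real" where
  "dyadic_ceiling m s = real (nat \<lceil>2 ^ m * s\<rceil>) / 2 ^ m"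

lemma dyadic_ceiling_nonneg: "0 \<le> dyadic_ceiling m s"
  by (simp add: dyadic_ceiling_def)

lemma dyadic_ceiling_mono: "s \<le> t \<Longrightarrow> dyadic_ceiling m s \<le> dyadic_ceiling m t"
  unfolding dyadic_ceiling_def
  by (intro divide_right_mono of_nat_mono nat_mono ceiling_mono mult_left_mono) auto

lemma dyadic_ceiling_measurable [measurable]: "dyadic_ceiling m \<in> borel_measurable borel"
  unfolding dyadic_ceiling_def by measurable

lemma dyadic_ceiling_tendsto:
  assumes "0 \<le> s"
  shows "(\<lambda>m. dyadic_ceiling m s) \<longlonglongrightarrow> s"
proof (rule tendsto_sandwich)
  have e: "dyadic_ceiling m s = of_int \<lceil>2 ^ m * s\<rceil> / 2 ^ m" for m
    using assms by (simp add: dyadic_ceiling_def)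
  show "\<forall>\<^sub>F m in sequentially. s \<le> dyadic_ceiling m s"
  proof (intro always_eventually allI)
    fix m
    have "2 ^ m * s \<le> of_int \<lceil>2 ^ m * s\<rceil>" by (rule le_of_int_ceiling)
    then show "s \<le> dyadic_ceiling m s" unfolding e by (simp add: pos_le_divide_eq mult.commute)
  qed
  show "\<forall>\<^sub>F m in sequentially. dyadic_ceiling m s \<le> s + (1 / 2) ^ m"
  proof (intro always_eventually allI)
    fix m
    have "of_int \<lceil>2 ^ m * s\<rceil> \<le> 2 ^ m * s + 1" by linarith
    also have "\<dots> = (s + (1 / 2) ^ m) * 2 ^ m" by (simp add: power_divide algebra_simps)
    finally show "dyadic_ceiling m s \<le> s + (1 / 2) ^ m" unfolding e by (simp add: pos_divide_le_eq)
  qed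
  show "(\<lambda>m. s + (1 / 2) ^ m) \<longlonglongrightarrow> s"
    using tendsto_add[OF tendsto_const[of s] LIMSEQ_realpow_zero[of "1/2"]] by simp
qed simp

section \<open>The subordinate process at two times\<close>

lemma process_events_sigma_algebra: "sigma_algebra (space P) (process_events P X)"
  unfolding process_events_def by (rule sigma_algebra_sigma_sets) auto

lemma process_measurable:
  fixes X :: "real \<Rightarrow> 'w \<Rightarrow> 'b::euclidean_space"
  assumes "0 \<le> t"
  shows "X t \<in> sigma (space P) (process_events P X) \<rightarrow>\<^sub>M borel"
proof (rule measurableI)
  fix A :: "'b set" assume A: "A \<in> sets borel"
  interpret E: sigma_algebra "space P" "process_events P X" by (rule process_events_sigma_algebra)
  have "X t -` A \<inter> space P \<in> process_events P X"
    unfolding process_events_def using A assms by (intro sigma_sets.Basic) auto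
  then show "X t -` A \<inter> space (sigma (space P) (process_events P X)) \<in> sets (sigma (space P) (process_events P X))"
    using E.space_closed by (simp add: sets_measure_of space_measure_of E.sigma_sets_eq)
qed simp

locale subordinate_brownian_motion = subordinator_process P S \<phi>
  for P :: "'w measure" and S :: "real \<Rightarrow> 'w \<Rightarrow> real" and \<phi> :: "real \<Rightarrow> real" +
  fixes B :: "real \<Rightarrow> 'w \<Rightarrow> 'a::euclidean_space"
  assumes bm: "brownian_motion P 0 B" and indep: "independent_processes P B S"
begin

lemma B_levy: "levy_process P 0 B"
  using bm by (simp add: brownian_motion_def)

lemma B_measurable: "0 \<le> t \<Longrightarrow> B t \<in> borel_measurable P"
  using B_levy by (simp add: levy_process_def)

definition gauss :: "real \<Rightarrow> 'a \<Rightarrow> real" where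
  "gauss a x = exp (- (a * (norm x)\<^sup>2))"

text \<open>The mean of \<open>gauss a\<close> at time \<open>s\<close> of Brownian motion; the absolute value makes the function bounded
  and continuous on the whole line.\<close>

definition gauss_mean :: "real \<Rightarrow> real \<Rightarrow> real" where
  "gauss_mean a s = (1 + 4 * a * \<bar>s\<bar>) powr (- real DIM('a) / 2)"

lemma gauss_measurable [measurable]: "gauss a \<in> borel_measurable borel"
  unfolding gauss_def by measurable

lemma gauss_mean_measurable [measurable]: "gauss_mean a \<in> borel_measurable borel"
  unfolding gauss_mean_def by measurable

lemma gauss_bounds: "0 \<le> a \<Longrightarrow> 0 \<le> gauss a x" "0 \<le> a \<Longrightarrow> gauss a x \<le> 1"
  by (auto simp: gauss_def)

lemma gauss_mean_bounds: "0 \<le> a \<Longrightarrow> 0 \<le> gauss_mean a s" "0 \<le> a \<Longrightarrow> gauss_mean a s \<le> 1"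
proof -
  show "0 \<le> a \<Longrightarrow> 0 \<le> gauss_mean a s" by (simp add: gauss_mean_def)
  assume "0 \<le> a"
  then have "(1 + 4 * a * \<bar>s\<bar>) powr (- real DIM('a) / 2) \<le> 1 powr (- real DIM('a) / 2)"
    by (intro powr_mono2') auto
  then show "gauss_mean a s \<le> 1" by (simp add: gauss_mean_def)
qed

lemma gauss_mean_antimono: "0 \<le> a \<Longrightarrow> 0 \<le> s \<Longrightarrow> s \<le> t \<Longrightarrow> gauss_mean a t \<le> gauss_mean a s"
  unfolding gauss_mean_def by (intro powr_mono2') (auto intro!: mult_left_mono add_pos_nonneg)

lemma gauss_mean_continuous: "0 \<le> a \<Longrightarrow> isCont (gauss_mean a) s"
  unfolding gauss_mean_def by (intro continuous_intros) (auto simp: add_pos_nonneg less_imp_neq[symmetric])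

lemma brownian_gauss:
  assumes "0 \<le> a" "0 \<le> t"
  shows "expectation (\<lambda>\<omega>. gauss a (B t \<omega>)) = gauss_mean a t"
proof -
  have [measurable]: "B t \<in> borel_measurable P" "B 0 \<in> borel_measurable P" using B_measurable assms by auto
  have "expectation (\<lambda>\<omega>. gauss a (B t \<omega>)) = expectation (\<lambda>\<omega>. exp (- (a * (norm (B t \<omega> - B 0 \<omega>))\<^sup>2)))"
    unfolding gauss_def
  proof (rule integral_cong_AE)
    show "AE \<omega> in P. exp (- (a * (norm (B t \<omega>))\<^sup>2)) = exp (- (a * (norm (B t \<omega> - B 0 \<omega>))\<^sup>2))"
      using levy_processD(3)[OF B_levy] by eventually_elim simp
  qed measurable
  also have "\<dots> = (1 + 4 * a * t) powr (- real DIM('a) / 2)"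
    using bm assms by (intro expectation_gaussian) (auto simp: prob_space_axioms brownian_motion_def)
  finally show ?thesis using assms by (simp add: gauss_mean_def)
qed

lemma brownian_two_time:
  assumes "0 \<le> a" "0 \<le> p" "p \<le> q"
  shows "(\<integral>\<^sup>+\<omega>. ennreal (gauss a (B p \<omega>) * gauss a (B q \<omega> - B p \<omega>)) \<partial>P) = ennreal (gauss_mean a p * gauss_mean a (q - p))"
proof -
  have [measurable]: "B p \<in> borel_measurable P" "B q \<in> borel_measurable P" using B_measurable assms by auto
  have "(\<integral>\<^sup>+\<omega>. ennreal (gauss a (B p \<omega>) * gauss a (B q \<omega> - B p \<omega>)) \<partial>P) =
      ennreal (expectation (\<lambda>\<omega>. gauss a (B p \<omega>) * gauss a (B q \<omega> - B p \<omega>)))"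
    using assms gauss_bounds by (intro nn_integral_eq_integral integrable_const_bound[of _ 1] AE_I2) (auto intro!: mult_le_one mult_nonneg_nonneg)
  also have "expectation (\<lambda>\<omega>. gauss a (B p \<omega>) * gauss a (B q \<omega> - B p \<omega>)) = gauss_mean a p * gauss_mean a (q - p)"
    using assms by (subst levy_process_two_time[OF B_levy]) (auto simp: gauss_bounds brownian_gauss)
  finally show ?thesis .
qed

text \<open>Replacing \<open>S t\<close> by its dyadic approximation leaves countably many times at which \<open>B\<close> is evaluated, so
  that this process is measurable without any joint measurability of \<open>B\<close>.\<close>

definition dyadic_subordinate :: "nat \<Rightarrow> real \<Rightarrow> 'w \<Rightarrow> 'a" where
  "dyadic_subordinate m t \<omega> = B (dyadic_ceiling m (S t \<omega>)) \<omega>"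

lemma dyadic_subordinate_measurable [measurable]:
  assumes "0 \<le> t"
  shows "dyadic_subordinate m t \<in> borel_measurable P"
proof -
  have [measurable]: "S t \<in> borel_measurable P" using assms by simp
  have [measurable]: "B (real i / 2 ^ m) \<in> borel_measurable P" for i by (rule B_measurable) simp
  have "(\<lambda>\<omega>. B (real (nat \<lceil>2 ^ m * S t \<omega>\<rceil>) / 2 ^ m) \<omega>) \<in> borel_measurable P"
    by (rule measurable_compose_countable[where f = "\<lambda>i. B (real i / 2 ^ m)"]) measurable
  moreover have "dyadic_subordinate m t = (\<lambda>\<omega>. B (real (nat \<lceil>2 ^ m * S t \<omega>\<rceil>) / 2 ^ m) \<omega>)"
    by (rule ext) (simp add: dyadic_subordinate_def dyadic_ceiling_def)
  ultimately show ?thesis by simp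
qed

text \<open>Both random times are encoded in one index, and the family of products of Gaussian functions of \<open>B\<close> is
  averaged over it by independence.\<close>

lemma dyadic_subordinate_gauss:
  assumes "0 \<le> a" "0 \<le> s" "s \<le> t"
  shows "expectation (\<lambda>\<omega>. gauss a (dyadic_subordinate m s \<omega>) * gauss a (dyadic_subordinate m t \<omega> - dyadic_subordinate m s \<omega>)) =
    expectation (\<lambda>\<omega>. gauss_mean a (dyadic_ceiling m (S s \<omega>)) * gauss_mean a (dyadic_ceiling m (S t \<omega>) - dyadic_ceiling m (S s \<omega>)))"
proof -
  have t: "0 \<le> t" using assms by simp
  have [measurable]: "dyadic_subordinate m s \<in> borel_measurable P" "dyadic_subordinate m t \<in> borel_measurable P"
    "S s \<in> borel_measurable P" "S t \<in> borel_measurable P" using assms by auto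
  define N where "N \<omega> = prod_encode (nat \<lceil>2 ^ m * S s \<omega>\<rceil>, nat \<lceil>2 ^ m * S t \<omega>\<rceil>)" for \<omega>
  define F where "F n \<omega> = ennreal (gauss a (B (real (fst (prod_decode n)) / 2 ^ m) \<omega>) *
      gauss a (B (real (snd (prod_decode n)) / 2 ^ m) \<omega> - B (real (fst (prod_decode n)) / 2 ^ m) \<omega>))" for n \<omega>
  have FN: "F (N \<omega>) \<omega> = ennreal (gauss a (dyadic_subordinate m s \<omega>) * gauss a (dyadic_subordinate m t \<omega> - dyadic_subordinate m s \<omega>))" for \<omega>
    by (simp add: F_def N_def dyadic_subordinate_def dyadic_ceiling_def)
  have Fgen: "F n \<in> borel_measurable Q" if "\<And>i. B (real i / 2 ^ m) \<in> borel_measurable Q" for n Q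
    using that[of "fst (prod_decode n)", measurable] that[of "snd (prod_decode n)", measurable] unfolding F_def by measurable
  have Ngen: "N \<in> Q \<rightarrow>\<^sub>M count_space UNIV" if [measurable]: "S s \<in> borel_measurable Q" "S t \<in> borel_measurable Q" for Q
    unfolding N_def by measurable
  have "(\<integral>\<^sup>+\<omega>. F (N \<omega>) \<omega> \<partial>P) = (\<integral>\<^sup>+\<omega>. (\<integral>\<^sup>+\<omega>'. F (N \<omega>) \<omega>' \<partial>P) \<partial>P)"
  proof (rule nn_integral_indep_countable_mixture)
    show "indep_set (process_events P B) (process_events P S)"
      using indep by (simp add: independent_processes_def)
    show "F n \<in> borel_measurable (sigma (space P) (process_events P B))" for n
      by (rule Fgen) (rule process_measurable, simp)
    show "N \<in> sigma (space P) (process_events P S) \<rightarrow>\<^sub>M count_space UNIV"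
      using assms by (intro Ngen process_measurable) auto
    show "F n \<in> borel_measurable P" for n by (rule Fgen) (rule B_measurable, simp)
    show "N \<in> P \<rightarrow>\<^sub>M count_space UNIV" by (rule Ngen) fact+
  qed (rule process_events_sigma_algebra)+
  also have "\<dots> = (\<integral>\<^sup>+\<omega>. ennreal (gauss_mean a (dyadic_ceiling m (S s \<omega>)) * gauss_mean a (dyadic_ceiling m (S t \<omega>) - dyadic_ceiling m (S s \<omega>))) \<partial>P)"
  proof (rule nn_integral_cong_AE)
    show "AE \<omega> in P. (\<integral>\<^sup>+\<omega>'. F (N \<omega>) \<omega>' \<partial>P) = ennreal (gauss_mean a (dyadic_ceiling m (S s \<omega>)) * gauss_mean a (dyadic_ceiling m (S t \<omega>) - dyadic_ceiling m (S s \<omega>)))"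
      using S_mono[OF assms(2,3)]
    proof eventually_elim
      fix \<omega> assume "S s \<omega> \<le> S t \<omega>"
      then have "(\<integral>\<^sup>+\<omega>'. ennreal (gauss a (B (dyadic_ceiling m (S s \<omega>)) \<omega>') *
          gauss a (B (dyadic_ceiling m (S t \<omega>)) \<omega>' - B (dyadic_ceiling m (S s \<omega>)) \<omega>')) \<partial>P)
        = ennreal (gauss_mean a (dyadic_ceiling m (S s \<omega>)) * gauss_mean a (dyadic_ceiling m (S t \<omega>) - dyadic_ceiling m (S s \<omega>)))"
        using assms by (intro brownian_two_time dyadic_ceiling_nonneg dyadic_ceiling_mono)
      then show "(\<integral>\<^sup>+\<omega>'. F (N \<omega>) \<omega>' \<partial>P) = ennreal (gauss_mean a (dyadic_ceiling m (S s \<omega>)) * gauss_mean a (dyadic_ceiling m (S t \<omega>) - dyadic_ceiling m (S s \<omega>)))"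
        by (simp add: F_def N_def dyadic_ceiling_def)
    qed
  qed
  finally have eq: "(\<integral>\<^sup>+\<omega>. ennreal (gauss a (dyadic_subordinate m s \<omega>) * gauss a (dyadic_subordinate m t \<omega> - dyadic_subordinate m s \<omega>)) \<partial>P) =
      (\<integral>\<^sup>+\<omega>. ennreal (gauss_mean a (dyadic_ceiling m (S s \<omega>)) * gauss_mean a (dyadic_ceiling m (S t \<omega>) - dyadic_ceiling m (S s \<omega>))) \<partial>P)"
    unfolding FN .
  have "expectation (\<lambda>\<omega>. gauss a (dyadic_subordinate m s \<omega>) * gauss a (dyadic_subordinate m t \<omega> - dyadic_subordinate m s \<omega>)) =
      enn2real (\<integral>\<^sup>+\<omega>. ennreal (gauss a (dyadic_subordinate m s \<omega>) * gauss a (dyadic_subordinate m t \<omega> - dyadic_subordinate m s \<omega>)) \<partial>P)"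
    using assms gauss_bounds by (intro integral_eq_nn_integral) auto
  also have "\<dots> = expectation (\<lambda>\<omega>. gauss_mean a (dyadic_ceiling m (S s \<omega>)) * gauss_mean a (dyadic_ceiling m (S t \<omega>) - dyadic_ceiling m (S s \<omega>)))"
    unfolding eq using assms gauss_mean_bounds by (intro integral_eq_nn_integral[symmetric]) auto
  finally show ?thesis .
qed

text \<open>The paths of \<open>B\<close> are only almost surely continuous and \<open>P\<close> need not be complete, so
  \<open>subordinate B S t\<close> may fail to be measurable. This limit is a measurable version of it.\<close>

definition limit_subordinate :: "real \<Rightarrow> 'w \<Rightarrow> 'a" where
  "limit_subordinate t \<omega> = lim (\<lambda>m. dyadic_subordinate m t \<omega>)"

lemma limit_subordinate_measurable: "0 \<le> t \<Longrightarrow> limit_subordinate t \<in> borel_measurable P"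
  unfolding limit_subordinate_def by (rule borel_measurable_lim_metric) simp

lemma dyadic_subordinate_tendsto: "AE \<omega> in P. \<forall>t\<ge>0. (\<lambda>m. dyadic_subordinate m t \<omega>) \<longlonglongrightarrow> subordinate B S t \<omega>"
proof -
  have "AE \<omega> in P. continuous_on {0..} (\<lambda>t. B t \<omega>)" using bm by (simp add: brownian_motion_def)
  with AE_space[of P] show ?thesis
  proof eventually_elim
    fix \<omega> assume c: "continuous_on {0..} (\<lambda>t. B t \<omega>)" and \<omega>: "\<omega> \<in> space P"
    show "\<forall>t\<ge>0. (\<lambda>m. dyadic_subordinate m t \<omega>) \<longlonglongrightarrow> subordinate B S t \<omega>"
      unfolding dyadic_subordinate_def subordinate_def
      by (intro allI impI continuous_on_tendsto_compose[OF c] dyadic_ceiling_tendsto S_nonneg \<omega>)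
        (auto simp: dyadic_ceiling_nonneg S_nonneg \<omega>)
  qed
qed

lemma limit_subordinate_eq: "AE \<omega> in P. \<forall>t\<ge>0. limit_subordinate t \<omega> = subordinate B S t \<omega>"
  using dyadic_subordinate_tendsto by eventually_elim (auto simp: limit_subordinate_def intro: limI)

text \<open>Both sides of \<open>dyadic_subordinate_gauss\<close> converge by dominated convergence; the limit on the right
  factorises by the independent stationary increments of \<open>S\<close>.\<close>

lemma limit_subordinate_two_time:
  assumes "0 \<le> a" "0 \<le> s" "s \<le> t"
  shows "expectation (\<lambda>\<omega>. gauss a (limit_subordinate s \<omega>) * gauss a (limit_subordinate t \<omega> - limit_subordinate s \<omega>)) =
    expectation (\<lambda>\<omega>. gauss_mean a (S s \<omega>)) * expectation (\<lambda>\<omega>. gauss_mean a (S (t - s) \<omega>))"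
proof -
  have t: "0 \<le> t" using assms by simp
  have [measurable]: "dyadic_subordinate m s \<in> borel_measurable P" "dyadic_subordinate m t \<in> borel_measurable P" for m using assms by auto
  have [measurable]: "S s \<in> borel_measurable P" "S t \<in> borel_measurable P" using assms by auto
  have [measurable]: "limit_subordinate s \<in> borel_measurable P" "limit_subordinate t \<in> borel_measurable P" using limit_subordinate_measurable assms by auto
  have gc: "isCont (gauss a) x" for x unfolding gauss_def by (intro continuous_intros)
  have "(\<lambda>m. expectation (\<lambda>\<omega>. gauss a (dyadic_subordinate m s \<omega>) * gauss a (dyadic_subordinate m t \<omega> - dyadic_subordinate m s \<omega>))) \<longlonglongrightarrow>
      expectation (\<lambda>\<omega>. gauss a (limit_subordinate s \<omega>) * gauss a (limit_subordinate t \<omega> - limit_subordinate s \<omega>))"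
  proof (rule integral_dominated_convergence[where w = "\<lambda>_. 1"])
    show "AE \<omega> in P. (\<lambda>m. gauss a (dyadic_subordinate m s \<omega>) * gauss a (dyadic_subordinate m t \<omega> - dyadic_subordinate m s \<omega>)) \<longlonglongrightarrow> gauss a (limit_subordinate s \<omega>) * gauss a (limit_subordinate t \<omega> - limit_subordinate s \<omega>)"
      using dyadic_subordinate_tendsto limit_subordinate_eq
    proof eventually_elim
      fix \<omega> assume l: "\<forall>t\<ge>0. (\<lambda>m. dyadic_subordinate m t \<omega>) \<longlonglongrightarrow> subordinate B S t \<omega>" "\<forall>t\<ge>0. limit_subordinate t \<omega> = subordinate B S t \<omega>"
      then have "(\<lambda>m. dyadic_subordinate m s \<omega>) \<longlonglongrightarrow> limit_subordinate s \<omega>" "(\<lambda>m. dyadic_subordinate m t \<omega>) \<longlonglongrightarrow> limit_subordinate t \<omega>" using assms by auto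
      then show "(\<lambda>m. gauss a (dyadic_subordinate m s \<omega>) * gauss a (dyadic_subordinate m t \<omega> - dyadic_subordinate m s \<omega>)) \<longlonglongrightarrow> gauss a (limit_subordinate s \<omega>) * gauss a (limit_subordinate t \<omega> - limit_subordinate s \<omega>)"
        by (intro tendsto_mult isCont_tendsto_compose[OF gc] tendsto_diff)
    qed
    show "AE \<omega> in P. norm (gauss a (dyadic_subordinate m s \<omega>) * gauss a (dyadic_subordinate m t \<omega> - dyadic_subordinate m s \<omega>)) \<le> 1" for m
      using assms gauss_bounds by (intro AE_I2) (auto simp: abs_mult intro!: mult_le_one)
  qed auto
  moreover have "(\<lambda>m. expectation (\<lambda>\<omega>. gauss a (dyadic_subordinate m s \<omega>) * gauss a (dyadic_subordinate m t \<omega> - dyadic_subordinate m s \<omega>))) \<longlonglongrightarrow>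
      expectation (\<lambda>\<omega>. gauss_mean a (S s \<omega>) * gauss_mean a (S t \<omega> - S s \<omega>))"
    unfolding dyadic_subordinate_gauss[OF assms]
  proof (rule integral_dominated_convergence[where w = "\<lambda>_. 1"])
    show "AE \<omega> in P. (\<lambda>m. gauss_mean a (dyadic_ceiling m (S s \<omega>)) * gauss_mean a (dyadic_ceiling m (S t \<omega>) - dyadic_ceiling m (S s \<omega>)))
       \<longlonglongrightarrow> gauss_mean a (S s \<omega>) * gauss_mean a (S t \<omega> - S s \<omega>)"
      using assms(1,2) t
      by (intro AE_I2 tendsto_mult isCont_tendsto_compose[OF gauss_mean_continuous] tendsto_diff dyadic_ceiling_tendsto S_nonneg) auto
    show "AE \<omega> in P. norm (gauss_mean a (dyadic_ceiling m (S s \<omega>)) * gauss_mean a (dyadic_ceiling m (S t \<omega>) - dyadic_ceiling m (S s \<omega>))) \<le> 1" for m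
      using assms gauss_mean_bounds by (intro AE_I2) (auto simp: abs_mult intro!: mult_le_one)
  qed auto
  ultimately have "expectation (\<lambda>\<omega>. gauss a (limit_subordinate s \<omega>) * gauss a (limit_subordinate t \<omega> - limit_subordinate s \<omega>)) = expectation (\<lambda>\<omega>. gauss_mean a (S s \<omega>) * gauss_mean a (S t \<omega> - S s \<omega>))"
    by (rule LIMSEQ_unique)
  also have "\<dots> = expectation (\<lambda>\<omega>. gauss_mean a (S s \<omega>)) * expectation (\<lambda>\<omega>. gauss_mean a (S (t - s) \<omega>))"
    using assms by (intro levy_process_two_time[OF S_levy]) (auto simp: gauss_mean_bounds)
  finally show ?thesis .
qed

lemma limit_subordinate_one_time:
  assumes "0 \<le> a" "0 \<le> t"
  shows "expectation (\<lambda>\<omega>. gauss a (limit_subordinate t \<omega>)) = expectation (\<lambda>\<omega>. gauss_mean a (S t \<omega>))"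
proof -
  have [measurable]: "S 0 \<in> borel_measurable P" by simp
  have "expectation (\<lambda>\<omega>. gauss_mean a (S 0 \<omega>)) = expectation (\<lambda>\<omega>. 1)"
    using S_0 by (intro integral_cong_AE) (auto simp: gauss_mean_def)
  moreover have "gauss a 0 = 1" by (simp add: gauss_def)
  ultimately show ?thesis using limit_subordinate_two_time[of a t t] assms by (simp add: prob_space)
qed

text \<open>The second moment argument bounds the sum over integer times. Since \<open>S\<close> increases, the mean of
  \<open>gauss_mean 1 (S t)\<close> decreases in \<open>t\<close>, so the sum dominates the integral over all times.\<close>

lemma transient_imp_green_finite:
  assumes trans: "transient P (subordinate B S)"
  shows "(\<integral>\<^sup>+s. ennreal (gauss_mean 1 s) \<partial>potential_measure P S) < \<infinity>"
proof -
  define a where "a k = expectation (\<lambda>\<omega>. gauss_mean 1 (S (real k) \<omega>))" for k :: nat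
  have Si: "integrable P (\<lambda>\<omega>. gauss_mean c (S t \<omega>))" if "0 \<le> t" "0 \<le> c" for t c
    using that S_measurable[OF that(1), measurable] gauss_mean_bounds[of c]
    by (intro integrable_const_bound[of _ 1] AE_I2) auto
  have a0: "0 \<le> a k" for k unfolding a_def by (intro integral_nonneg_AE AE_I2 gauss_mean_bounds) simp
  obtain H where H: "\<And>n. (\<Sum>k<n. a k) \<le> H"
  proof (rule transient_imp_bounded_partial_sums[of "\<lambda>k. limit_subordinate (real k)" a "2 powr (real DIM('a) / 2)"])
    show "limit_subordinate (real k) \<in> borel_measurable P" for k by (rule limit_subordinate_measurable) simp
    show "expectation (\<lambda>\<omega>. exp (- (norm (limit_subordinate (real j) \<omega>))\<^sup>2) * exp (- (norm (limit_subordinate (real k) \<omega> - limit_subordinate (real j) \<omega>))\<^sup>2)) = a j * a (k - j)" if "j \<le> k" for j k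
      using limit_subordinate_two_time[of 1 "real j" "real k"] that by (simp add: gauss_def a_def of_nat_diff)
    show "expectation (\<lambda>\<omega>. exp (- (norm (limit_subordinate (real k) \<omega>))\<^sup>2)) = a k" for k
      using limit_subordinate_one_time[of 1 "real k"] by (simp add: gauss_def a_def)
    show "expectation (\<lambda>\<omega>. exp (- ((norm (limit_subordinate (real k) \<omega>))\<^sup>2 / 2))) \<le> 2 powr (real DIM('a) / 2) * a k" for k
    proof -
      have "expectation (\<lambda>\<omega>. exp (- ((norm (limit_subordinate (real k) \<omega>))\<^sup>2 / 2))) = expectation (\<lambda>\<omega>. gauss_mean (1/2) (S (real k) \<omega>))"
        using limit_subordinate_one_time[of "1/2" "real k"] by (simp add: gauss_def)
      also have "\<dots> \<le> expectation (\<lambda>\<omega>. 2 powr (real DIM('a) / 2) * gauss_mean 1 (S (real k) \<omega>))"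
      proof (rule integral_mono)
        show "gauss_mean (1/2) (S (real k) \<omega>) \<le> 2 powr (real DIM('a) / 2) * gauss_mean 1 (S (real k) \<omega>)" for \<omega>
        proof -
          define s where "s = \<bar>S (real k) \<omega>\<bar>"
          (* Since 1 + 4 s \<le> 2 (1 + 2 s). *)
          have "(1 + 2 * s) powr (- real DIM('a) / 2) \<le> ((1 + 4 * s) / 2) powr (- real DIM('a) / 2)"
            by (rule powr_mono2') (auto simp: s_def)
          also have "\<dots> = 2 powr (real DIM('a) / 2) * (1 + 4 * s) powr (- real DIM('a) / 2)"
            using powr_minus_divide[of "2::real" "real DIM('a) / 2"] by (simp add: powr_divide)
          finally show ?thesis by (simp add: gauss_mean_def s_def)
        qed
      qed (auto intro!: Si)
      finally show ?thesis by (simp add: a_def)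
    qed
    show "AE \<omega> in P. filterlim (\<lambda>k. norm (limit_subordinate (real k) \<omega>)) at_top sequentially"
      using trans[unfolded transient_def] limit_subordinate_eq
    proof eventually_elim
      fix \<omega> assume f: "filterlim (\<lambda>t. norm (subordinate B S t \<omega>)) at_top at_top" and y: "\<forall>t\<ge>0. limit_subordinate t \<omega> = subordinate B S t \<omega>"
      have "filterlim (\<lambda>k. norm (subordinate B S (real k) \<omega>)) at_top sequentially"
        by (rule filterlim_compose[OF f filterlim_real_sequentially])
      then show "filterlim (\<lambda>k. norm (limit_subordinate (real k) \<omega>)) at_top sequentially" using y by simp
    qed
  qed (use a0 in auto)
  have bound: "(\<integral>\<^sup>+\<omega>. ennreal (gauss_mean 1 (S t \<omega>)) \<partial>P) * indicator {0..} t \<le> (\<Sum>k. ennreal (a k) * indicator {real k..<real k + 1} t)" for t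
  proof (cases "0 \<le> t")
    case True
    define k where "k = nat \<lfloor>t\<rfloor>"
    have k: "real k \<le> t" "t < real k + 1" using True by (auto simp: k_def)
    have "(\<integral>\<^sup>+\<omega>. ennreal (gauss_mean 1 (S t \<omega>)) \<partial>P) \<le> (\<integral>\<^sup>+\<omega>. ennreal (gauss_mean 1 (S (real k) \<omega>)) \<partial>P)"
    proof (rule nn_integral_mono_AE)
      show "AE \<omega> in P. ennreal (gauss_mean 1 (S t \<omega>)) \<le> ennreal (gauss_mean 1 (S (real k) \<omega>))"
        using S_mono[OF of_nat_0_le_iff k(1)] AE_space[of P]
        by eventually_elim (auto intro!: ennreal_leI gauss_mean_antimono S_nonneg)
    qed
    also have "\<dots> = ennreal (a k)" unfolding a_def
      by (intro nn_integral_eq_integral Si AE_I2 gauss_mean_bounds) auto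
    also have "\<dots> = (\<Sum>i\<in>{k}. ennreal (a i) * indicator {real i..<real i + 1} t)" using k by simp
    also have "\<dots> \<le> (\<Sum>i. ennreal (a i) * indicator {real i..<real i + 1} t)" by (rule sum_le_suminf) auto
    finally show ?thesis using True by simp
  qed simp
  have "(\<integral>\<^sup>+s. ennreal (gauss_mean 1 s) \<partial>potential_measure P S) = (\<integral>\<^sup>+t\<in>{0..}. (\<integral>\<^sup>+\<omega>. ennreal (gauss_mean 1 (S t \<omega>)) \<partial>P) \<partial>lborel)"
    by (rule nn_integral_potential_measure) simp
  also have "\<dots> \<le> (\<integral>\<^sup>+t. (\<Sum>k. ennreal (a k) * indicator {real k..<real k + 1} t) \<partial>lborel)"
    by (intro nn_integral_mono bound)
  also have "\<dots> = (\<Sum>k. \<integral>\<^sup>+t. ennreal (a k) * indicator {real k..<real k + 1} t \<partial>lborel)"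
    by (rule nn_integral_suminf) simp
  also have "\<dots> = (\<Sum>k. ennreal (a k))" by (simp add: nn_integral_cmult_indicator)
  also have "\<dots> \<le> ennreal H"
  proof (rule suminf_le_const)
    show "(\<Sum>k<n. ennreal (a k)) \<le> ennreal H" for n
      using H[of n] a0 by (simp add: sum_ennreal ennreal_leI)
  qed simp
  finally show ?thesis using ennreal_less_top le_less_trans by (metis infinity_ennreal_def)
qed

section \<open>Comparison of the Green function\<close>

text \<open>This translates between the potential measure and its density: \<open>\<phi> = 1 / laplace\<close> and
  \<open>\<phi>' / \<phi>\<^sup>2 = moment\<close>, and transience supplies the integrability of the density at infinity.\<close>

lemma green_comparable:
  assumes A1: "cond_A1 (potential_measure P S)" and A3: "cond_A3 \<phi> \<sigma> l\<^sub>0 \<delta>"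
    and B': "cond_B DIM('a) \<phi> l\<^sub>0 \<delta>" and trans: "transient P (subordinate B S)"
  shows "comparable_at_0 (green DIM('a) (potential_measure P S))
           (\<lambda>r. r powr (- real DIM('a) - 2) * deriv \<phi> (r powr (-2)) / (\<phi> (r powr (-2)))\<^sup>2)"
proof -
  define U where "U = potential_measure P S"
  obtain u where u: "\<And>t. 0 < t \<Longrightarrow> 0 < u t" "antimono_on {0<..} u"
    and U: "U = density lborel (\<lambda>t. ennreal (u t) * indicator {0<..} t)"
    using A1 unfolding cond_A1_def U_def by blast
  define v where "v t = indicator {0<..} t *\<^sub>R u t" for t
  have v [simp]: "0 < t \<Longrightarrow> v t = u t" "t \<le> 0 \<Longrightarrow> v t = 0" for t by (auto simp: v_def)
  have v0: "0 \<le> v t" for t using u(1)[of t] by (cases "0 < t") auto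
  have vm [measurable]: "v \<in> borel_measurable borel"
  proof -
    have "mono_on {0<..} (\<lambda>t. - u t)" using u(2) by (auto simp: monotone_on_def)
    then have "(\<lambda>t. - u t) \<in> borel_measurable (restrict_space borel {0<..})"
      by (rule borel_measurable_mono_on_fnc)
    then have "(\<lambda>t. - (- u t)) \<in> borel_measurable (restrict_space borel {0<..})"
      by (rule borel_measurable_uminus)
    then show ?thesis unfolding v_def by (subst (asm) borel_measurable_restrict_space_iff) auto
  qed
  have Ud: "U = density lborel (\<lambda>t. ennreal (v t))"
    unfolding U by (intro arg_cong[where f = "density lborel"] ext) (auto simp: indicator_def not_less)
  have nnU: "(\<integral>\<^sup>+t. ennreal (f t) \<partial>U) = (\<integral>\<^sup>+t. ennreal (f t * v t) \<partial>lborel)"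
    if [measurable]: "f \<in> borel_measurable borel" and "\<And>t. 0 \<le> f t" for f
    unfolding Ud using that v0 by (subst nn_integral_density) (auto simp: ennreal_mult mult.commute)
  have "emeasure U {0} = (\<integral>\<^sup>+t. 0 \<partial>(lborel :: real measure))"
    unfolding Ud by (subst emeasure_density, simp, simp, intro nn_integral_cong) (auto simp: indicator_def)
  then have phi: "0 < \<phi> l" if "0 < l" for l using phi_pos that by (simp add: U_def)
  have lapl: "has_bochner_integral lborel (\<lambda>t. exp (- (l * t)) * v t) (1 / \<phi> l)" if l: "0 < l" for l
  proof (rule has_bochner_integral_nn_integral)
    show "(\<integral>\<^sup>+t. ennreal (exp (- (l * t)) * v t) \<partial>lborel) = ennreal (1 / \<phi> l)"
      using laplace_transform_potential_measure[OF l phi[OF l]] nnU[of "\<lambda>t. exp (- (l * t))"] by (simp add: U_def)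
  qed (use v0 phi[OF l] in auto)
  interpret decreasing_density v
  proof
    fix s t :: real assume "0 < s" "s \<le> t"
    then show "v t \<le> v s" using u(2) by (auto simp: monotone_on_def)
  next
    fix l :: real assume "0 < l"
    then show "integrable lborel (\<lambda>t. exp (- (l * t)) * v t)" using lapl by (auto intro: integrable.intros)
  qed (use u in auto)
  have laplace: "\<phi> l = 1 / laplace l" if "0 < l" for l
    using has_bochner_integral_integral_eq[OF lapl[OF that]] by (simp add: laplace_def)
  have deriv: "deriv \<phi> l = moment l / (laplace l)\<^sup>2" if l: "0 < l" for l
  proof (rule DERIV_imp_deriv)
    have "((\<lambda>l. 1 / laplace l) has_real_derivative moment l / (laplace l)\<^sup>2) (at l)"
      using laplace_has_derivative[OF l] laplace_pos[OF l] by (auto intro!: derivative_eq_intros simp: power2_eq_square)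
    then show "(\<phi> has_real_derivative moment l / (laplace l)\<^sup>2) (at l)"
      by (rule has_field_derivative_transform_within_open[of _ _ _ "{0<..}"]) (use l laplace in auto)
  qed
  have dpos: "0 < moment l / (laplace l)\<^sup>2" if "0 < l" for l using moment_pos[OF that] laplace_pos[OF that] by simp
  have pos: "0 < \<sigma>" "0 < l\<^sub>0" "0 < \<delta>" using A3 by (auto simp: cond_A3_def)
  have A3': "moment (l * x) / (laplace (l * x))\<^sup>2 \<le> \<sigma> * x powr (- \<delta>) * (moment l / (laplace l)\<^sup>2)" if "1 \<le> x" "l\<^sub>0 \<le> l" for x l
  proof -
    have l: "0 < l" "0 < l * x" using that pos by auto
    have "deriv \<phi> (l * x) / deriv \<phi> l \<le> \<sigma> * x powr (- \<delta>)" using A3 that by (auto simp: cond_A3_def)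
    then show ?thesis unfolding deriv[OF l(1)] deriv[OF l(2)] by (simp only: pos_divide_le_eq[OF dpos[OF l(1)]])
  qed
  have B'': "\<exists>\<sigma>'>0. \<exists>\<delta>'. \<delta>' < 1 + DIM('a) / 2 \<and> \<delta>' < 2 * \<delta> + (real DIM('a) - 2) / 2 \<and>
       (\<forall>x\<ge>1. \<forall>l\<ge>l\<^sub>0. \<sigma>' * x powr (- \<delta>') * (moment l / (laplace l)\<^sup>2) \<le> moment (l * x) / (laplace (l * x))\<^sup>2)" if d2: "DIM('a) \<le> 2"
  proof -
    obtain \<sigma>' \<delta>' where *: "0 < \<sigma>'" "\<delta>' < min (1 + real DIM('a) / 2) (2 * \<delta> + (real DIM('a) - 2) / 2)"
      "\<forall>x\<ge>1. \<forall>l\<ge>l\<^sub>0. \<sigma>' * x powr (- \<delta>') \<le> deriv \<phi> (l * x) / deriv \<phi> l"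
      using B' d2 unfolding cond_B_def by auto
    have "\<sigma>' * x powr (- \<delta>') * (moment l / (laplace l)\<^sup>2) \<le> moment (l * x) / (laplace (l * x))\<^sup>2" if "1 \<le> x" "l\<^sub>0 \<le> l" for x l
    proof -
      have l: "0 < l" "0 < l * x" using that pos by auto
      have "\<sigma>' * x powr (- \<delta>') \<le> deriv \<phi> (l * x) / deriv \<phi> l" using *(3) that by blast
      then show ?thesis unfolding deriv[OF l(1)] deriv[OF l(2)] by (simp only: pos_le_divide_eq[OF dpos[OF l(1)]])
    qed
    then show ?thesis using * by auto
  qed
  have tail: "integrable lborel (\<lambda>t. (1 + 4 * t) powr (- real DIM('a) / 2) * v t)"
  proof (rule integrableI_nonneg)
    have "(\<integral>\<^sup>+t. ennreal ((1 + 4 * t) powr (- real DIM('a) / 2) * v t) \<partial>lborel) =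
        (\<integral>\<^sup>+t. ennreal (gauss_mean 1 t * v t) \<partial>lborel)"
    proof (rule nn_integral_cong)
      fix t show "ennreal ((1 + 4 * t) powr (- real DIM('a) / 2) * v t) = ennreal (gauss_mean 1 t * v t)"
        by (cases "0 < t") (auto simp: gauss_mean_def)
    qed
    also have "\<dots> < \<infinity>" using transient_imp_green_finite[OF trans] nnU[of "gauss_mean 1"] gauss_mean_bounds by (simp add: U_def)
    finally show "(\<integral>\<^sup>+t. ennreal ((1 + 4 * t) powr (- real DIM('a) / 2) * v t) \<partial>lborel) < \<infinity>" .
  qed (use v0 in auto)
  have green: "green DIM('a) U r = (\<integral>t. heat_kernel DIM('a) (r\<^sup>2) t * v t \<partial>lborel)" for r
    unfolding green_def set_lebesgue_integral_def Ud
    using v0 by (subst integral_density) (auto intro!: Bochner_Integration.integral_cong simp: heat_kernel_def indicator_def)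
  have asym: "r powr (- real DIM('a) - 2) * deriv \<phi> (r powr (-2)) / (\<phi> (r powr (-2)))\<^sup>2 =
      (r\<^sup>2) powr (- real DIM('a) / 2 - 1) * moment (1 / r\<^sup>2)" if r: "0 < r" for r
  proof -
    have "r powr (-2) = 1 / r\<^sup>2" using powr_minus_divide[of r 2] r by simp
    moreover have "0 < 1 / r\<^sup>2" using r by simp
    moreover have "(r\<^sup>2) powr (- real DIM('a) / 2 - 1) = r powr (- real DIM('a) - 2)"
    proof -
      have "(r powr 2) powr (- real DIM('a) / 2 - 1) = r powr (- real DIM('a) - 2)"
        unfolding powr_powr by (simp add: algebra_simps)
      then show ?thesis using r by simp
    qed
    ultimately show ?thesis using laplace_pos[of "1 / r\<^sup>2"] by (simp add: deriv laplace power_divide)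
  qed
  obtain c K \<rho>\<^sub>0 where c: "0 < c" "0 < K" "0 < \<rho>\<^sub>0"
    and lo: "\<And>\<rho>. 0 < \<rho> \<Longrightarrow> \<rho> \<le> \<rho>\<^sub>0 \<Longrightarrow> c * (\<rho> powr (- real DIM('a) / 2 - 1) * moment (1 / \<rho>)) \<le> (\<integral>t. heat_kernel DIM('a) \<rho> t * v t \<partial>lborel)"
    and up: "\<And>\<rho>. 0 < \<rho> \<Longrightarrow> \<rho> \<le> \<rho>\<^sub>0 \<Longrightarrow> (\<integral>t. heat_kernel DIM('a) \<rho> t * v t \<partial>lborel) \<le> K * (\<rho> powr (- real DIM('a) / 2 - 1) * moment (1 / \<rho>))"
    by (rule heat_integral_comparable[OF _ pos A3' B'' tail]) (auto simp: Suc_le_eq)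
  have ev: "\<forall>\<^sub>F r in at_right 0. 0 < r \<and> r\<^sup>2 \<le> \<rho>\<^sub>0"
  proof -
    have "\<forall>\<^sub>F r in at_right 0. r \<in> {0<..<sqrt \<rho>\<^sub>0}" using c by (intro eventually_at_right_real) simp
    then show ?thesis
    proof eventually_elim
      fix r assume "r \<in> {0<..<sqrt \<rho>\<^sub>0}"
      then have "0 < r" "r\<^sup>2 \<le> (sqrt \<rho>\<^sub>0)\<^sup>2" by (auto intro!: power_mono)
      then show "0 < r \<and> r\<^sup>2 \<le> \<rho>\<^sub>0" using c by simp
    qed
  qed
  show ?thesis unfolding comparable_at_0_def U_def[symmetric]
  proof (rule exI[of _ c], rule conjI[OF c(1)], rule exI[of _ K], rule conjI[OF c(2)])
    show "\<forall>\<^sub>F r in at_right 0.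
      c \<le> green DIM('a) U r / (r powr (- real DIM('a) - 2) * deriv \<phi> (r powr (-2)) / (\<phi> (r powr (-2)))\<^sup>2) \<and>
      green DIM('a) U r / (r powr (- real DIM('a) - 2) * deriv \<phi> (r powr (-2)) / (\<phi> (r powr (-2)))\<^sup>2) \<le> K"
      using ev
    proof eventually_elim
      fix r :: real assume r: "0 < r \<and> r\<^sup>2 \<le> \<rho>\<^sub>0"
      then have r2: "0 < r\<^sup>2" "r\<^sup>2 \<le> \<rho>\<^sub>0" by auto
      have m: "0 < (r\<^sup>2) powr (- real DIM('a) / 2 - 1) * moment (1 / r\<^sup>2)"
        using r2 moment_pos[of "1 / r\<^sup>2"] by simp
      show "c \<le> green DIM('a) U r / (r powr (- real DIM('a) - 2) * deriv \<phi> (r powr (-2)) / (\<phi> (r powr (-2)))\<^sup>2) \<and>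
        green DIM('a) U r / (r powr (- real DIM('a) - 2) * deriv \<phi> (r powr (-2)) / (\<phi> (r powr (-2)))\<^sup>2) \<le> K"
        unfolding asym[OF conjunct1[OF r]] green pos_le_divide_eq[OF m] pos_divide_le_eq[OF m]
        using lo[OF r2] up[OF r2] by simp
    qed
  qed
qed

end

theorem proposition3p5:
  fixes P :: "'w measure"
    and B :: "real \<Rightarrow> 'w \<Rightarrow> 'a::euclidean_space"
    and S :: "real \<Rightarrow> 'w \<Rightarrow> real"
    and \<phi> :: "real \<Rightarrow> real"
    and \<sigma> l\<^sub>0 \<delta> :: real
  assumes "brownian_motion P 0 B"
    and "subordinator P S"
    and "independent_processes P B S"
    and "laplace_exponent P S \<phi>"
    and "cond_A1 (potential_measure P S)"
    and "cond_A3 \<phi> \<sigma> l\<^sub>0 \<delta>"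
    and "cond_B DIM('a) \<phi> l\<^sub>0 \<delta>"
    and "transient P (subordinate B S)"
  shows "comparable_at_0
           (green DIM('a) (potential_measure P S))
           (\<lambda>r. r powr (- real DIM('a) - 2) * deriv \<phi> (r powr (-2)) / (\<phi> (r powr (-2)))\<^sup>2)"
proof -
  interpret subordinate_brownian_motion P S \<phi> B
    using assms(1-4) by unfold_locales
  show ?thesis using assms(5-8) by (rule green_comparable)
qed

end
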